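(* Let $M\in\mathbb{R}^{d\times d}$ and $A_M=\begin{pmatrix}I&M+\frac12I \\ I&M-\frac12I\end{pmatrix}$. The distribution $\mathcal{B}_{A_M}$ satisfies the weak support property (i.e. both the time weak support property and the frequency weak support property) if and only if it is a $\tau$-Wigner distribution, namely if and only if $M=\left(\tau-\tfrac12\right)I$ for some $\tau\in[0,1]$.
   Context: For $A\in\mathrm{GL}(2d,\mathbb{R})$ with $d\times d$ blocks $A_{ij}$, $\mathcal{B}_Af(x,\omega)=\int_{\mathbb{R}^d}e^{-2\pi i\omega\cdot y}f(A_{11}x+A_{12}y)\overline{f(A_{21}x+A_{22}y)}\,dy$. For $\tau\in[0,1]$ the $\tau$-Wigner distribution is $W_\tau f(x,\omega)=\int_{\mathbb{R}^d}e^{-2\pi i\omega\cdot y}f(x+\tau y)\overline{f(x-(1-\tau)y)}\,dy$. The support of a function is the smallest closed set outside of which it vanishes a.e. For $E\subset\mathbb{R}^d$, $\mathcal{C}(E)$ is the closed convex hull of $E$. Let $\pi_x,\pi_\omega:\mathbb{R}^{2d}_{(x,\omega)}\to\mathbb{R}^d$ be the projections $(x,\omega)\mapsto x$ and $(x,\omega)\mapsto\omega$. A distribution $Q$, $f\mapsto Qf$, satisfies the time weak support property if $\pi_x(\mathrm{supp}\,Qf)\subset\mathcal{C}(\mathrm{supp}\,f)$, and the frequency weak support property if $\pi_\omega(\mathrm{supp}\,Qf)\subset\mathcal{C}(\mathrm{supp}\,\hat f)$, for every signal $f\in\mathcal{S}(\mathbb{R}^d)$, where $\hat f(\omega)=\int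 e^{-2\pi ix\cdot\omega}f(x)\,dx$. *)

theory Defs
  imports "HOL-Analysis.Analysis"
begin

definition partial_deriv :: "'d \<Rightarrow> (real^'d \<Rightarrow> complex) \<Rightarrow> real^'d \<Rightarrow> complex" where
  "partial_deriv j f x = frechet_derivative f (at x) (axis j 1)"

text \<open>A list of coordinates plays the role of the multi-index of a derivative: all iterated
  partial derivatives, in every order, are considered. Requiring each of them to be (totally)
  differentiable everywhere is the same as smoothness.\<close>

definition schwartz :: "(real^'d \<Rightarrow> complex) set" where
  "schwartz = {f. \<forall>js.
      (\<forall>x. fold partial_deriv js f differentiable (at x)) \<and>
      (\<forall>\<alpha> :: 'd \<Rightarrow> nat. bounded (range (\<lambda>x.
          of_real (\<Prod>i\<in>UNIV. (x $ i) ^ \<alpha> i) * fold partial_deriv js f x)))}"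

definition fourier :: "(real^'d \<Rightarrow> complex) \<Rightarrow> real^'d \<Rightarrow> complex" where
  "fourier f \<omega> = (LINT x|lborel. exp (- 2 * pi * \<i> * (x \<bullet> \<omega>)) * f x)"

definition ae_supp :: "('a::euclidean_space \<Rightarrow> complex) \<Rightarrow> 'a set" where
  "ae_supp f = \<Inter> {F. closed F \<and> (AE x in lborel. x \<notin> F \<longrightarrow> f x = 0)}"

text \<open>The intersection is itself a member of the family, so it is indeed the smallest closed set
  outside of which the function vanishes almost everywhere.\<close>

lemma closed_ae_supp: "closed (ae_supp f)"
  unfolding ae_supp_def by (rule closed_Inter) auto

lemma AE_ae_supp: "AE x in lborel. x \<notin> ae_supp f \<longrightarrow> f x = 0"
proof -
  define \<U> where "\<U> = {U. open U \<and> (AE x in lborel. x \<in> U \<longrightarrow> f x = 0)}"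
  obtain \<V> where V: "\<V> \<subseteq> \<U>" "countable \<V>" "\<Union>\<V> = \<Union>\<U>"
    using Lindelof[of \<U>] unfolding \<U>_def by blast
  have "AE x in lborel. \<forall>U\<in>\<V>. x \<in> U \<longrightarrow> f x = 0"
    using V unfolding \<U>_def by (subst AE_ball_countable) auto
  moreover have "x \<in> \<Union>\<V>" if "x \<notin> ae_supp f" for x
  proof -
    from that obtain F where F: "closed F" "AE y in lborel. y \<notin> F \<longrightarrow> f y = 0" "x \<notin> F"
      unfolding ae_supp_def by blast
    then have "- F \<in> \<U>" by (auto simp: \<U>_def open_Compl)
    with F show ?thesis using V by blast
  qed
  ultimately show ?thesis by (auto elim!: eventually_mono)
qed

text \<open>Square matrices of size 2d are indexed by the sum type, the summands of which index the
  two block rows and block columns.\<close>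

definition block_matrix ::
    "real^'d^'d \<Rightarrow> real^'d^'d \<Rightarrow> real^'d^'d \<Rightarrow> real^'d^'d \<Rightarrow> real^('d + 'd)^('d + 'd)" where
  "block_matrix P Q R S = (\<chi> i j. case (i, j) of
      (Inl k, Inl l) \<Rightarrow> P $ k $ l | (Inl k, Inr l) \<Rightarrow> Q $ k $ l
    | (Inr k, Inl l) \<Rightarrow> R $ k $ l | (Inr k, Inr l) \<Rightarrow> S $ k $ l)"

definition block11 :: "real^('d + 'd)^('d + 'd) \<Rightarrow> real^'d^'d" where
  "block11 A = (\<chi> k l. A $ Inl k $ Inl l)"
definition block12 :: "real^('d + 'd)^('d + 'd) \<Rightarrow> real^'d^'d" where
  "block12 A = (\<chi> k l. A $ Inl k $ Inr l)"
definition block21 :: "real^('d + 'd)^('d + 'd) \<Rightarrow> real^'d^'d" where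
  "block21 A = (\<chi> k l. A $ Inr k $ Inl l)"
definition block22 :: "real^('d + 'd)^('d + 'd) \<Rightarrow> real^'d^'d" where
  "block22 A = (\<chi> k l. A $ Inr k $ Inr l)"

definition matrix_wigner ::
    "real^('d + 'd)^('d + 'd) \<Rightarrow> (real^'d \<Rightarrow> complex) \<Rightarrow> (real^'d) \<times> (real^'d) \<Rightarrow> complex" where
  "matrix_wigner A f = (\<lambda>(x, \<omega>). LINT y|lborel. exp (- 2 * pi * \<i> * (\<omega> \<bullet> y)) *
      f (block11 A *v x + block12 A *v y) * cnj (f (block21 A *v x + block22 A *v y)))"

definition tau_wigner ::
    "real \<Rightarrow> (real^'d \<Rightarrow> complex) \<Rightarrow> (real^'d) \<times> (real^'d) \<Rightarrow> complex" where
  "tau_wigner \<tau> f = (\<lambda>(x, \<omega>). LINT y|lborel. exp (- 2 * pi * \<i> * (\<omega> \<bullet> y)) *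
      f (x + \<tau> *\<^sub>R y) * cnj (f (x - (1 - \<tau>) *\<^sub>R y)))"

definition time_weak_support ::
    "((real^'d \<Rightarrow> complex) \<Rightarrow> (real^'d) \<times> (real^'d) \<Rightarrow> complex) \<Rightarrow> bool" where
  "time_weak_support Q \<longleftrightarrow>
    (\<forall>f\<in>schwartz. fst ` ae_supp (Q f) \<subseteq> closure (convex hull (ae_supp f)))"

definition frequency_weak_support ::
    "((real^'d \<Rightarrow> complex) \<Rightarrow> (real^'d) \<times> (real^'d) \<Rightarrow> complex) \<Rightarrow> bool" where
  "frequency_weak_support Q \<longleftrightarrow>
    (\<forall>f\<in>schwartz. snd ` ae_supp (Q f) \<subseteq> closure (convex hull (ae_supp (fourier f))))"

definition weak_support ::
    "((real^'d \<Rightarrow> complex) \<Rightarrow> (real^'d) \<times> (real^'d) \<Rightarrow> complex) \<Rightarrow> bool" where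
  "weak_support Q \<longleftrightarrow> time_weak_support Q \<and> frequency_weak_support Q"

definition cohen_matrix :: "real^'d^'d \<Rightarrow> real^('d + 'd)^('d + 'd)" where
  "cohen_matrix M = block_matrix (mat 1) (M + (1/2) *\<^sub>R mat 1) (mat 1) (M - (1/2) *\<^sub>R mat 1)"

text \<open>The matrix lies in the general linear group for every \<open>M\<close>.\<close>

lemma block_matrix_mult:
  "block_matrix P Q R S ** block_matrix P' Q' R' S' =
   block_matrix (P ** P' + Q ** R') (P ** Q' + Q ** S') (R ** P' + S ** R') (R ** Q' + S ** S')"
  by (simp add: vec_eq_iff block_matrix_def matrix_matrix_mult_def UNIV_Plus_UNIV[symmetric]
      sum.Plus split: sum.split del: UNIV_Plus_UNIV)

lemma block_matrix_1: "block_matrix (mat 1) 0 0 (mat 1) = mat 1"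
  by (simp add: vec_eq_iff block_matrix_def mat_def split: sum.split)

lemma invertible_cohen_matrix: "invertible (cohen_matrix M)"
proof -
  have half: "(1/2) *\<^sub>R X + (1/2) *\<^sub>R X = X" for X :: "real^'a^'a"
    by (simp add: vec_eq_iff)
  have neg: "X ** (- mat 1) = - X" for X :: "real^'a^'a"
    using matrix_mul_rid[of X] by (simp add: vec_eq_iff matrix_matrix_mult_def sum_negf)
  have "cohen_matrix M **
      block_matrix ((1/2) *\<^sub>R mat 1 - M) ((1/2) *\<^sub>R mat 1 + M) (mat 1) (- mat 1) = mat 1"
    unfolding cohen_matrix_def block_matrix_mult block_matrix_1[symmetric]
    by (simp add: neg half)
  then show ?thesis
    by (metis invertible_right_inverse)
qed

end

theory Submission
  imports Defs "HOL-Probability.Probability" "HOL-Real_Asymp.Real_Asymp"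
begin

text \<open>
  Write \<open>P = M + (1/2) I\<close>. Then the distribution at \<open>(x, \<omega>)\<close> is the Fourier transform, in \<open>y\<close>, of
  \<open>f (x + P y) * cnj (f (x - (I - P) y))\<close>, and it is the \<open>\<tau>\<close>-Wigner distribution when \<open>P = \<tau> I\<close>.

  Sufficiency, in time: if \<open>0 \<le> \<tau> \<le> 1\<close>, then \<open>x\<close> is a convex combination of the two points
  \<open>x + \<tau> y\<close> and \<open>x - (1 - \<tau>) y\<close>, so outside the closed convex hull of the support of \<open>f\<close> the
  integrand is identically zero (\<open>tau_wigner_vanishes_time\<close>).

  Sufficiency, in frequency: inserting the Fourier inversion formula for both factors exhibits the
  integrand as a superposition of waves in \<open>y\<close> with frequencies \<open>\<tau> \<xi> + (1 - \<tau>) \<eta>\<close>, where \<open>\<xi>\<close> and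
  \<open>\<eta>\<close> range over the support of the Fourier transform of \<open>f\<close>. These frequencies lie in the closed
  convex hull \<open>C\<close> of that support, and an integrable superposition of waves with frequencies in \<open>C\<close>
  has a Fourier transform that vanishes off \<open>C\<close> (\<open>spectral_gap_vanishing\<close>). Inversion is only used
  in a Gaussian-regularised form: damping the Fourier transform of \<open>f\<close> by a Gaussian amounts to
  replacing \<open>f\<close> by its average \<open>heat s f\<close> over Gaussian displacements
  (\<open>heat_eq_windowed_inversion\<close>). As the Fourier transform of \<open>f\<close> is bounded, the damped integrals
  converge. The averages tend to \<open>f\<close> as \<open>s\<close> tends to 0, and they inherit
  the polynomial decay of \<open>f\<close> uniformly in \<open>s \<le> 1\<close> (\<open>heat_decay\<close>), so that dominated convergence
  removes the regularisation (\<open>tau_wigner_vanishes_frequency\<close>).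

  Necessity: the time property for one smooth bump \<open>f\<close>, positive on the open unit ball and zero
  outside, already forces \<open>P = \<tau> I\<close>. For \<open>a\<close> and \<open>b\<close> in the ball put \<open>x = (I - P) a + P b\<close> and
  \<open>y = a - b\<close>. The integrand at \<open>(x, y)\<close> is \<open>f a * f b > 0\<close>, so by uniqueness of Fourier transforms
  \<open>x\<close> is in the projected support, and hence in the closed ball (\<open>time_support_ball\<close>). Pairing the
  resulting bound with a vector \<open>u\<close> and taking the supremum over \<open>a\<close> and \<open>b\<close> gives
  \<open>|P\<^sup>T u| + |u - P\<^sup>T u| \<le> |u|\<close>. This is the equality case of the triangle inequality, so \<open>P\<^sup>T u\<close> is a
  multiple of \<open>u\<close> with factor in \<open>[0, 1]\<close> (\<open>transpose_eigenvector\<close>). A matrix for which every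
  vector is an eigenvector is scalar.
\<close>

section \<open>Product integrals and affine substitution\<close>

text \<open>
  Lebesgue measure on a Euclidean space is the image of the product of one-dimensional Lebesgue
  measures over the basis. Hence functions that factor over the coordinates, here the Gaussian, its
  Fourier integrand and a polynomial weight, are reduced to the real line.
\<close>

lemma lborel_integral_product:
  fixes g :: "'a::euclidean_space \<Rightarrow> real \<Rightarrow> 'b::{real_normed_field,banach,second_countable_topology}"
  assumes "\<And>b. b \<in> Basis \<Longrightarrow> integrable lborel (g b)"
  shows lborel_integrable_prod: "integrable lborel (\<lambda>x. \<Prod>b\<in>Basis. g b (x \<bullet> b))"
    and lborel_integral_prod: "(\<integral>x. (\<Prod>b\<in>Basis. g b (x \<bullet> b)) \<partial>lborel) = (\<Prod>b\<in>Basis. integral\<^sup>L lborel (g b))"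
proof -
  interpret product_sigma_finite "\<lambda>_::'a. lborel :: real measure" ..
  have m: "(\<lambda>x::'a. \<Prod>b\<in>Basis. g b (x \<bullet> b)) \<in> borel_measurable borel"
  proof (intro borel_measurable_prod)
    fix b :: 'a assume "b \<in> Basis"
    then have [measurable]: "g b \<in> borel_measurable borel"
      using borel_measurable_integrable[OF assms] by simp
    show "(\<lambda>x. g b (x \<bullet> b)) \<in> borel_measurable borel" by measurable
  qed
  have eq: "(\<Prod>b\<in>Basis. g b ((\<Sum>c\<in>Basis. f c *\<^sub>R c) \<bullet> b)) = (\<Prod>b\<in>Basis. g b (f b))" for f :: "'a \<Rightarrow> real"
    by (intro prod.cong) (auto simp: inner_sum_left_Basis)
  have T: "(\<lambda>f. \<Sum>b\<in>Basis. f b *\<^sub>R b :: 'a) \<in> (\<Pi>\<^sub>M b\<in>Basis. lborel) \<rightarrow>\<^sub>M borel"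
    by measurable
  show "integrable lborel (\<lambda>x. \<Prod>b\<in>Basis. g b (x \<bullet> b))"
    unfolding lborel_eq[where 'a='a]
    by (subst integrable_distr_eq[OF T m]) (auto simp: eq intro!: product_integrable_prod assms)
  show "(\<integral>x. (\<Prod>b\<in>Basis. g b (x \<bullet> b)) \<partial>lborel) = (\<Prod>b\<in>Basis. integral\<^sup>L lborel (g b))"
    unfolding lborel_eq[where 'a='a]
    by (subst integral_distr[OF T m]) (simp add: eq product_integral_prod[OF _ assms])
qed

lemma lborel_affine_change:
  fixes f :: "'a::euclidean_space \<Rightarrow> 'b::{banach,second_countable_topology}"
  assumes c: "c \<noteq> 0"
  shows lborel_integrable_affine: "integrable lborel f \<Longrightarrow> integrable lborel (\<lambda>x. f (t + c *\<^sub>R x))"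
    and lborel_integral_affine: "f \<in> borel_measurable borel \<Longrightarrow>
      integral\<^sup>L lborel f = \<bar>c\<bar> ^ DIM('a) *\<^sub>R (\<integral>x. f (t + c *\<^sub>R x) \<partial>lborel)"
proof -
  have T: "(\<lambda>x::'a. t + c *\<^sub>R x) \<in> lborel \<rightarrow>\<^sub>M borel" by measurable
  show "integrable lborel (\<lambda>x. f (t + c *\<^sub>R x))" if i: "integrable lborel f"
  proof -
    have m: "f \<in> borel_measurable borel" using i by (auto dest: borel_measurable_integrable)
    have "integrable (density (distr lborel borel (\<lambda>x::'a. t + c *\<^sub>R x)) (\<lambda>_. ennreal (\<bar>c\<bar> ^ DIM('a)))) f"
      using i lborel_affine[OF c, of t] by (simp add: ennreal_power)
    then have "integrable (distr lborel borel (\<lambda>x::'a. t + c *\<^sub>R x)) (\<lambda>x. \<bar>c\<bar> ^ DIM('a) *\<^sub>R f x)"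
      using m by (subst (asm) integrable_density) auto
    then have "integrable lborel (\<lambda>x. \<bar>c\<bar> ^ DIM('a) *\<^sub>R f (t + c *\<^sub>R x))"
      by (subst (asm) integrable_distr_eq[OF T]) (use m in auto)
    then have "integrable lborel (\<lambda>x. inverse (\<bar>c\<bar> ^ DIM('a)) *\<^sub>R \<bar>c\<bar> ^ DIM('a) *\<^sub>R f (t + c *\<^sub>R x))"
      by (rule integrable_scaleR_right)
    then show ?thesis using c by simp
  qed
  show "integral\<^sup>L lborel f = \<bar>c\<bar> ^ DIM('a) *\<^sub>R (\<integral>x. f (t + c *\<^sub>R x) \<partial>lborel)"
    if m: "f \<in> borel_measurable borel"
  proof -
    have "integral\<^sup>L lborel f
        = integral\<^sup>L (density (distr lborel borel (\<lambda>x::'a. t + c *\<^sub>R x)) (\<lambda>_. ennreal (\<bar>c\<bar> ^ DIM('a)))) f"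
      using lborel_affine[OF c, of t] by (simp add: ennreal_power)
    also have "\<dots> = (\<integral>x. \<bar>c\<bar> ^ DIM('a) *\<^sub>R f x \<partial>distr lborel borel (\<lambda>x::'a. t + c *\<^sub>R x))"
      using m by (subst integral_density) auto
    also have "\<dots> = (\<integral>x. \<bar>c\<bar> ^ DIM('a) *\<^sub>R f (t + c *\<^sub>R x) \<partial>lborel)"
      using m by (subst integral_distr[OF T]) auto
    finally show ?thesis by simp
  qed
qed

lemma cis_measurable [measurable]: "cis \<in> borel_measurable borel"
  by (intro borel_measurable_continuous_onI continuous_intros)

section \<open>The Gaussian and its Fourier transform\<close>

definition gauss :: "'a::euclidean_space \<Rightarrow> real" where
  "gauss x = (\<Prod>b\<in>Basis. std_normal_density (x \<bullet> b))"

lemma gauss_pos: "gauss x > 0"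
  unfolding gauss_def by (intro prod_pos) (simp add: normal_density_pos)

lemma gauss_exp:
  fixes x :: "'a::euclidean_space"
  shows "gauss x = gauss (0::'a) * exp (- (norm x)\<^sup>2 / 2)"
proof -
  have "gauss x = (\<Prod>b\<in>Basis. std_normal_density ((0::'a) \<bullet> b)) * (\<Prod>b\<in>Basis. exp (- (x \<bullet> b)\<^sup>2 / 2))"
    unfolding gauss_def prod.distrib[symmetric] by (intro prod.cong refl) (auto simp: std_normal_density_def)
  also have "(\<Prod>b\<in>Basis. exp (- (x \<bullet> b)\<^sup>2 / 2)) = exp (- (norm x)\<^sup>2 / 2)"
    by (simp add: exp_sum[symmetric] norm_eq_sqrt_inner euclidean_inner[of x x] power2_eq_square
        sum_divide_distrib sum_negf sum_nonneg)
  finally show ?thesis by (simp add: gauss_def)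
qed

lemma gauss_0: "gauss (0::'a::euclidean_space) * gauss (0::'a) * (2 * pi) ^ DIM('a) = 1"
proof -
  have "gauss (0::'a) = (1 / sqrt (2 * pi)) ^ DIM('a)"
    by (simp add: gauss_def std_normal_density_def)
  then have "gauss (0::'a) * gauss (0::'a) * (2 * pi) ^ DIM('a)
      = (1 / sqrt (2 * pi) * (1 / sqrt (2 * pi)) * (2 * pi)) ^ DIM('a)"
    by (simp only: power_mult_distrib)
  also have "1 / sqrt (2 * pi) * (1 / sqrt (2 * pi)) * (2 * pi) = 1"
    by (simp del: real_sqrt_mult)
  finally show ?thesis by simp
qed

lemma gauss_measurable [measurable]: "gauss \<in> borel_measurable borel"
  unfolding gauss_def by measurable

lemma gauss_integrable: "integrable lborel gauss"
  unfolding gauss_def by (intro lborel_integrable_prod) (simp add: integrable_normal_density)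

lemma gauss_integral: "integral\<^sup>L lborel (gauss :: 'a::euclidean_space \<Rightarrow> real) = 1"
proof -
  have "integral\<^sup>L lborel (gauss :: 'a::euclidean_space \<Rightarrow> real) = (\<Prod>b\<in>(Basis::'a set). integral\<^sup>L lborel std_normal_density)"
    unfolding gauss_def by (intro lborel_integral_prod) (simp add: integrable_normal_density)
  then show ?thesis by (simp add: integral_normal_density)
qed

text \<open>
  In one dimension this is the characteristic function of the standard normal distribution; both
  the density and the wave factor over the coordinates.
\<close>

lemma gauss_fourier:
  fixes u :: "'a::euclidean_space"
  shows "(\<integral>x. of_real (gauss x) * cis (x \<bullet> u) \<partial>lborel) = complex_of_real (exp (- (norm u)\<^sup>2 / 2))"
proof -
  have one: "(\<integral>x. of_real (std_normal_density x) * cis (x * t) \<partial>lborel) = complex_of_real (exp (- t\<^sup>2 / 2))" for t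
  proof -
    have "(\<integral>x. of_real (std_normal_density x) * cis (x * t) \<partial>lborel) = char std_normal_distribution t"
      unfolding char_def
      by (subst integral_density) (auto simp: cis_conv_exp scaleR_conv_of_real mult_ac intro!: Bochner_Integration.integral_cong)
    then show ?thesis by (simp add: char_std_normal_distribution)
  qed
  have int: "integrable lborel (\<lambda>x. of_real (std_normal_density x) * cis (x * t))" for t
    by (rule Bochner_Integration.integrable_bound[OF integrable_normal_density[of 1 0]])
      (auto simp: norm_mult)
  have cisprod: "(\<Prod>b\<in>A. cis (h b)) = cis (\<Sum>b\<in>A. h b)" if "finite A" for A :: "'a set" and h
    using that by induction (auto simp: cis_mult)
  have "(\<integral>x. of_real (gauss x) * cis (x \<bullet> u) \<partial>lborel)
      = (\<integral>x. (\<Prod>b\<in>Basis. of_real (std_normal_density (x \<bullet> b)) * cis ((x \<bullet> b) * (u \<bullet> b))) \<partial>lborel)"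
    by (simp add: gauss_def prod.distrib cisprod euclidean_inner[of _ u])
  also have "\<dots> = (\<Prod>b\<in>Basis. complex_of_real (exp (- (u \<bullet> b)\<^sup>2 / 2)))"
    by (subst lborel_integral_prod[OF int]) (simp add: one)
  also have "\<dots> = complex_of_real (exp (\<Sum>b\<in>Basis. - (u \<bullet> b)\<^sup>2 / 2))"
    by (simp add: exp_sum)
  also have "(\<Sum>b\<in>Basis. - (u \<bullet> b)\<^sup>2 / 2) = - (norm u)\<^sup>2 / 2"
    by (simp add: norm_eq_sqrt_inner euclidean_inner[of u u] power2_eq_square sum_nonneg
        sum_divide_distrib sum_negf)
  finally show ?thesis .
qed

text \<open>
  The Gaussian is used on the frequency side with the scaling that makes it the Fourier transform
  of the normal density with standard deviation \<open>s\<close>. It tends to 1 as \<open>s\<close> tends to 0.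
\<close>

definition window :: "real \<Rightarrow> 'a::euclidean_space \<Rightarrow> real" where
  "window s \<xi> = exp (- (norm ((2 * pi * s) *\<^sub>R \<xi>))\<^sup>2 / 2)"

lemma window_gauss: "window s \<xi> = gauss ((2 * pi * s) *\<^sub>R \<xi>) / gauss (0::'a)" for \<xi> :: "'a::euclidean_space"
  unfolding window_def gauss_exp[of "(2 * pi * s) *\<^sub>R \<xi>"] using gauss_pos[of "0::'a"] by simp

lemma window_measurable [measurable]: "window s \<in> borel_measurable borel"
  unfolding window_def by measurable

lemma window_bounds: "0 < window s \<xi>" "window s \<xi> \<le> 1"
  by (auto simp: window_def)

lemma window_integrable: "s > 0 \<Longrightarrow> integrable lborel (window s :: 'a::euclidean_space \<Rightarrow> real)"
  using lborel_integrable_affine[OF _ gauss_integrable, of "2 * pi * s" "0::'a"]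
  by (simp add: window_gauss[abs_def])

lemma window_fourier:
  fixes v :: "'a::euclidean_space"
  assumes s: "s > 0"
  shows "(\<integral>\<xi>. of_real (window s \<xi>) * cis (2 * pi * (\<xi> \<bullet> v)) \<partial>lborel)
    = complex_of_real (gauss ((1 / s) *\<^sub>R v) / s ^ DIM('a))"
proof -
  let ?c = "2 * pi * s" and ?u = "(1 / s) *\<^sub>R v" and ?g = "gauss (0::'a)"
  have c: "?c \<noteq> 0" using s by simp
  have g: "?g \<noteq> 0" using gauss_pos[of "0::'a"] by simp
  have eq: "of_real (window s \<xi>) * cis (2 * pi * (\<xi> \<bullet> v))
      = of_real (1 / ?g) * (of_real (gauss (0 + ?c *\<^sub>R \<xi>)) * cis ((0 + ?c *\<^sub>R \<xi>) \<bullet> ?u))" for \<xi>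
    using s by (simp add: window_gauss mult.assoc)
  have "complex_of_real (exp (- (norm ?u)\<^sup>2 / 2))
      = \<bar>?c\<bar> ^ DIM('a) *\<^sub>R (\<integral>\<xi>. of_real (gauss (0 + ?c *\<^sub>R \<xi>)) * cis ((0 + ?c *\<^sub>R \<xi>) \<bullet> ?u) \<partial>lborel)"
    unfolding gauss_fourier[symmetric] by (rule lborel_integral_affine[OF c]) measurable
  then have 1: "(\<integral>\<xi>. of_real (gauss (0 + ?c *\<^sub>R \<xi>)) * cis ((0 + ?c *\<^sub>R \<xi>) \<bullet> ?u) \<partial>lborel)
      = complex_of_real (exp (- (norm ?u)\<^sup>2 / 2) / ?c ^ DIM('a))"
    using s by (simp add: scaleR_conv_of_real field_simps)
  have "1 / ?g * (exp (- (norm ?u)\<^sup>2 / 2) / ?c ^ DIM('a)) = gauss ?u / s ^ DIM('a)"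
  proof -
    have "?c ^ DIM('a) = (2 * pi) ^ DIM('a) * s ^ DIM('a)" by (simp only: power_mult_distrib)
    then have "?g * ?c ^ DIM('a) = s ^ DIM('a) / ?g"
      using gauss_0[where 'a='a] g by (simp add: field_simps)
    then have "1 / ?g * (E / ?c ^ DIM('a)) = ?g * E / s ^ DIM('a)" for E
      using g s by (simp add: divide_simps) (simp add: mult_ac)
    then show ?thesis using gauss_exp[of ?u] by simp
  qed
  then show ?thesis
    unfolding eq integral_mult_right_zero 1 of_real_mult[symmetric] by simp
qed

section \<open>Superpositions of waves with a spectral gap\<close>

lemma integrable_tensor:
  fixes f :: "'a \<Rightarrow> 'c::{real_normed_field,banach,second_countable_topology}" and g :: "'b \<Rightarrow> 'c"
  assumes "sigma_finite_measure M" "sigma_finite_measure N" and f: "integrable M f" and g: "integrable N g"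
  shows "integrable (M \<Otimes>\<^sub>M N) (\<lambda>(x, y). f x * g y)"
proof -
  interpret M: sigma_finite_measure M by fact
  interpret N: sigma_finite_measure N by fact
  interpret pair_sigma_finite M N ..
  note [measurable] = borel_measurable_integrable[OF f] borel_measurable_integrable[OF g]
  show ?thesis
    by (rule Fubini_integrable) (use f g in \<open>auto simp: norm_mult\<close>)
qed

lemma integral_tensor:
  fixes f :: "'a \<Rightarrow> 'c::{real_normed_field,banach,second_countable_topology}" and g :: "'b \<Rightarrow> 'c"
  assumes "sigma_finite_measure M" "sigma_finite_measure N" and f: "integrable M f" and g: "integrable N g"
  shows "(\<integral>z. f (fst z) * g (snd z) \<partial>(M \<Otimes>\<^sub>M N)) = integral\<^sup>L M f * integral\<^sup>L N g"
proof -
  interpret M: sigma_finite_measure M by fact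
  interpret N: sigma_finite_measure N by fact
  interpret pair_sigma_finite M N ..
  have "(\<integral>z. f (fst z) * g (snd z) \<partial>(M \<Otimes>\<^sub>M N)) = (\<integral>x. (\<integral>y. f x * g y \<partial>N) \<partial>M)"
    using integral_fst[OF integrable_tensor[OF assms]] by (simp add: case_prod_unfold)
  then show ?thesis by simp
qed

lemma integrable_mult_phase:
  fixes f :: "'a \<Rightarrow> complex"
  assumes f: "integrable M f" and [measurable]: "\<theta> \<in> borel_measurable M"
  shows "integrable M (\<lambda>x. f x * cis (\<theta> x))"
  by (rule Bochner_Integration.integrable_bound[OF f])
    (use borel_measurable_integrable[OF f] in \<open>auto simp: norm_mult\<close>)

text \<open>
  Damping a superposition of waves by a window and analysing it at the frequency \<open>\<omega>\<close> weights each wave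
  by a Gaussian in the distance of its frequency from \<open>\<omega>\<close>. This is Fubini followed by the Fourier
  transform of the window. The frequencies \<open>T \<zeta>\<close> are indexed by a general measure space, as both
  Fourier inversion (one frequency variable) and the product of two inverted factors (two variables)
  are instances.
\<close>

lemma window_duality:
  fixes k :: "'b \<Rightarrow> complex" and T :: "'b \<Rightarrow> 'a::euclidean_space"
  assumes N: "sigma_finite_measure N" and k: "integrable N k" and T [measurable]: "T \<in> borel_measurable N"
    and s: "s > 0"
  shows "(\<integral>y. (\<integral>\<zeta>. k \<zeta> * cis (2 * pi * (y \<bullet> T \<zeta>)) \<partial>N) * of_real (window s y) * cis (- 2 * pi * (y \<bullet> \<omega>)) \<partial>lborel)
    = (\<integral>\<zeta>. k \<zeta> * of_real (gauss ((1 / s) *\<^sub>R (T \<zeta> - \<omega>)) / s ^ DIM('a)) \<partial>N)"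
proof -
  interpret N: sigma_finite_measure N by fact
  interpret pair_sigma_finite N "lborel :: 'a measure" ..
  note [measurable] = borel_measurable_integrable[OF k]
  let ?F = "\<lambda>\<zeta> y. k \<zeta> * of_real (window s y) * cis (2 * pi * (y \<bullet> (T \<zeta> - \<omega>)))"
  have "integrable (N \<Otimes>\<^sub>M lborel) (\<lambda>z. (case z of (\<zeta>, y) \<Rightarrow> k \<zeta> * of_real (window s y)) * cis (case z of (\<zeta>, y) \<Rightarrow> 2 * pi * (y \<bullet> (T \<zeta> - \<omega>))))"
    using s by (intro integrable_mult_phase integrable_tensor N k lborel.sigma_finite_measure_axioms
        integrable_of_real window_integrable) measurable
  then have int: "integrable (N \<Otimes>\<^sub>M lborel) (case_prod ?F)"
    by (simp add: case_prod_unfold)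
  have inner: "(\<integral>\<zeta>. ?F \<zeta> y \<partial>N)
      = (\<integral>\<zeta>. k \<zeta> * cis (2 * pi * (y \<bullet> T \<zeta>)) \<partial>N) * of_real (window s y) * cis (- 2 * pi * (y \<bullet> \<omega>))" for y
  proof -
    have eq: "?F \<zeta> y = (k \<zeta> * cis (2 * pi * (y \<bullet> T \<zeta>))) * (of_real (window s y) * cis (- 2 * pi * (y \<bullet> \<omega>)))" for \<zeta>
      using cis_mult[of "2 * pi * (y \<bullet> T \<zeta>)" "- 2 * pi * (y \<bullet> \<omega>)"]
      by (simp add: inner_diff_right algebra_simps)
    show ?thesis unfolding eq integral_mult_left_zero by (simp only: mult.assoc)
  qed
  have "(\<integral>\<zeta>. k \<zeta> * of_real (gauss ((1 / s) *\<^sub>R (T \<zeta> - \<omega>)) / s ^ DIM('a)) \<partial>N) = (\<integral>\<zeta>. (\<integral>y. ?F \<zeta> y \<partial>lborel) \<partial>N)"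
    unfolding window_fourier[OF s, symmetric] by (simp add: mult.assoc)
  also have "\<dots> = (\<integral>y. (\<integral>\<zeta>. ?F \<zeta> y \<partial>N) \<partial>lborel)"
    by (rule Fubini_integral[OF int, symmetric])
  finally show ?thesis unfolding inner by simp
qed

lemma tendsto_window: "s \<longlonglongrightarrow> 0 \<Longrightarrow> (\<lambda>n. window (s n) y) \<longlonglongrightarrow> 1"
proof -
  assume s: "s \<longlonglongrightarrow> 0"
  have "(\<lambda>n. exp (- (norm ((2 * pi * s n) *\<^sub>R y))\<^sup>2 / 2)) \<longlonglongrightarrow> exp (- (norm ((2 * pi * 0) *\<^sub>R y))\<^sup>2 / 2)"
    by (intro tendsto_intros s) auto
  then show ?thesis by (simp add: window_def)
qed

text \<open>
  By \<open>window_duality\<close> the damped Fourier integral of \<open>h\<close> at \<open>\<omega>\<close> is at most the total mass of \<open>k\<close>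
  times the value \<open>gauss (r / s) / s\<^sup>d\<close> of the Gaussian kernel at distance \<open>r\<close>, which tends to 0 with
  \<open>s\<close>. Since \<open>h\<close> is integrable, removing the damping recovers the Fourier integral itself.
\<close>

lemma spectral_gap_vanishing:
  fixes k :: "'b \<Rightarrow> complex" and T :: "'b \<Rightarrow> 'a::euclidean_space"
  assumes N: "sigma_finite_measure N" and k: "integrable N k" and T [measurable]: "T \<in> borel_measurable N"
    and h: "\<And>y. h y = (\<integral>\<zeta>. k \<zeta> * cis (2 * pi * (y \<bullet> T \<zeta>)) \<partial>N)"
    and h_int: "integrable lborel h"
    and r: "r > 0" and gap: "AE \<zeta> in N. k \<zeta> = 0 \<or> r \<le> norm (T \<zeta> - \<omega>)"
  shows "(\<integral>y. h y * cis (- 2 * pi * (y \<bullet> \<omega>)) \<partial>lborel) = 0"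
proof -
  note [measurable] = borel_measurable_integrable[OF k]
  note h_meas = borel_measurable_integrable[OF h_int]
  define s where "s n = 1 / real (Suc n)" for n
  have s_pos: "s n > 0" for n by (simp add: s_def)
  have s0: "s \<longlonglongrightarrow> 0" unfolding s_def using LIMSEQ_inverse_real_of_nat by (simp add: inverse_eq_divide)
  let ?J = "\<lambda>n. \<integral>y. h y * of_real (window (s n) y) * cis (- 2 * pi * (y \<bullet> \<omega>)) \<partial>lborel"
  let ?c = "\<lambda>n. gauss (0::'a) * exp (- (r * real (Suc n))\<^sup>2 / 2) * real (Suc n) ^ DIM('a)"
  have "?J \<longlonglongrightarrow> (\<integral>y. h y * 1 * cis (- 2 * pi * (y \<bullet> \<omega>)) \<partial>lborel)"
  proof (rule integral_dominated_convergence[where w = "\<lambda>y. norm (h y)"])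
    show "AE y in lborel. (\<lambda>n. h y * of_real (window (s n) y) * cis (- 2 * pi * (y \<bullet> \<omega>)))
        \<longlonglongrightarrow> h y * 1 * cis (- 2 * pi * (y \<bullet> \<omega>))"
      by (intro AE_I2 tendsto_intros tendsto_of_real[of _ 1, simplified] tendsto_window s0)
    show "AE y in lborel. norm (h y * of_real (window (s n) y) * cis (- 2 * pi * (y \<bullet> \<omega>))) \<le> norm (h y)" for n
      by (auto simp: norm_mult window_bounds abs_of_pos intro!: AE_I2 mult_left_le)
  qed (use h_int h_meas in \<open>auto intro!: integrable_norm\<close>)
  moreover have "?J \<longlonglongrightarrow> 0"
  proof (rule Lim_null_comparison)
    have "norm (?J n) \<le> (\<integral>\<zeta>. norm (k \<zeta>) * ?c n \<partial>N)" for n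
    proof -
      have "?J n = (\<integral>\<zeta>. k \<zeta> * of_real (gauss ((1 / s n) *\<^sub>R (T \<zeta> - \<omega>)) / s n ^ DIM('a)) \<partial>N)"
        unfolding h by (rule window_duality[OF N k T s_pos])
      also have "norm \<dots> \<le> (\<integral>\<zeta>. norm (k \<zeta>) * ?c n \<partial>N)"
      proof -
        have b: "AE \<zeta> in N. norm (k \<zeta> * of_real (gauss ((1 / s n) *\<^sub>R (T \<zeta> - \<omega>)) / s n ^ DIM('a))) \<le> norm (k \<zeta>) * ?c n"
          using gap
        proof eventually_elim
          case (elim \<zeta>)
          show ?case
          proof (cases "k \<zeta> = 0")
            case False
            with elim have "r * real (Suc n) \<le> norm ((1 / s n) *\<^sub>R (T \<zeta> - \<omega>))"
              by (simp add: s_def mult.commute mult_right_mono)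
            then have "(r * real (Suc n))\<^sup>2 \<le> (norm ((1 / s n) *\<^sub>R (T \<zeta> - \<omega>)))\<^sup>2"
              using r by (intro power_mono) auto
            then have "gauss ((1 / s n) *\<^sub>R (T \<zeta> - \<omega>)) \<le> gauss (0::'a) * exp (- (r * real (Suc n))\<^sup>2 / 2)"
              unfolding gauss_exp[of "(1 / s n) *\<^sub>R (T \<zeta> - \<omega>)"] using gauss_pos[of "0::'a"] by simp
            then have "gauss ((1 / s n) *\<^sub>R (T \<zeta> - \<omega>)) / s n ^ DIM('a) \<le> ?c n"
              by (simp add: s_def power_divide mult_right_mono)
            moreover have "norm (k \<zeta> * of_real (gauss ((1 / s n) *\<^sub>R (T \<zeta> - \<omega>)) / s n ^ DIM('a)))
                = norm (k \<zeta>) * (gauss ((1 / s n) *\<^sub>R (T \<zeta> - \<omega>)) / s n ^ DIM('a))"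
              using s_pos[of n] by (simp add: norm_mult norm_divide norm_power gauss_pos abs_of_pos)
            ultimately show ?thesis by (simp only: mult_left_mono norm_ge_zero)
          qed simp
        qed
        have i: "integrable N (\<lambda>\<zeta>. norm (k \<zeta>) * ?c n)" using k by auto
        have "(\<integral>\<zeta>. norm (k \<zeta> * of_real (gauss ((1 / s n) *\<^sub>R (T \<zeta> - \<omega>)) / s n ^ DIM('a))) \<partial>N)
            \<le> (\<integral>\<zeta>. norm (k \<zeta>) * ?c n \<partial>N)"
          by (rule integral_mono_AE'[OF i b]) (simp add: gauss_pos less_imp_le)
        then show ?thesis
          by (rule order_trans[OF integral_norm_bound])
      qed
      finally show ?thesis .
    qed
    then show "\<forall>\<^sub>F n in sequentially. norm (?J n) \<le> (\<integral>\<zeta>. norm (k \<zeta>) \<partial>N) * ?c n" by simp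
    have "(\<lambda>n. exp (- (r * real (Suc n))\<^sup>2 / 2) * real (Suc n) ^ DIM('a)) \<longlonglongrightarrow> 0"
      using r by real_asymp
    then have "(\<lambda>n. (\<integral>\<zeta>. norm (k \<zeta>) \<partial>N) * (gauss (0::'a) * (exp (- (r * real (Suc n))\<^sup>2 / 2) * real (Suc n) ^ DIM('a)))) \<longlonglongrightarrow> 0"
      by (intro tendsto_mult_right_zero)
    then show "(\<lambda>n. (\<integral>\<zeta>. norm (k \<zeta>) \<partial>N) * ?c n) \<longlonglongrightarrow> 0" by (simp only: mult.assoc)
  qed
  ultimately show ?thesis using LIMSEQ_unique by fastforce
qed

section \<open>Gaussian averages and Fourier inversion\<close>

definition heat :: "real \<Rightarrow> ('a::euclidean_space \<Rightarrow> complex) \<Rightarrow> 'a \<Rightarrow> complex" where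
  "heat s f z = (\<integral>t. f (z + s *\<^sub>R t) * of_real (gauss t) \<partial>lborel)"

text \<open>
  The Fourier transform of \<open>f\<close> is itself a superposition of waves, with the frequency \<open>- x\<close> for the
  coefficient \<open>f x\<close>. Thus \<open>window_duality\<close> turns the damped inversion integral into an average of \<open>f\<close>
  against the normal density centred at \<open>z\<close>.
\<close>

lemma heat_eq_windowed_inversion:
  fixes f :: "'a::euclidean_space \<Rightarrow> complex"
  assumes f: "integrable lborel f" and s: "s > 0"
  shows "(\<integral>\<xi>. (\<integral>x. f x * cis (- 2 * pi * (x \<bullet> \<xi>)) \<partial>lborel) * of_real (window s \<xi>) * cis (2 * pi * (\<xi> \<bullet> z)) \<partial>lborel)
    = heat s f z"
proof -
  note [measurable] = borel_measurable_integrable[OF f]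
  have even: "gauss (- t) = gauss t" for t :: 'a
    by (simp add: gauss_exp[of t] gauss_exp[of "-t"])
  have "(\<integral>\<xi>. (\<integral>x. f x * cis (- 2 * pi * (x \<bullet> \<xi>)) \<partial>lborel) * of_real (window s \<xi>) * cis (2 * pi * (\<xi> \<bullet> z)) \<partial>lborel)
      = (\<integral>x. f x * of_real (gauss ((1 / s) *\<^sub>R (- x - - z)) / s ^ DIM('a)) \<partial>lborel)"
    using window_duality[OF lborel.sigma_finite_measure_axioms f _ s, of uminus "- z"]
    by (simp add: inner_commute)
  also have "\<dots> = s ^ DIM('a) *\<^sub>R (\<integral>t. f (z + s *\<^sub>R t) * of_real (gauss ((1 / s) *\<^sub>R (- (z + s *\<^sub>R t) - - z)) / s ^ DIM('a)) \<partial>lborel)"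
    using s by (subst lborel_integral_affine[of s _ z]) auto
  also have "\<dots> = heat s f z"
    using s by (simp add: heat_def even scaleR_conv_of_real)
  finally show ?thesis .
qed

lemma tendsto_heat:
  fixes f :: "'a::euclidean_space \<Rightarrow> complex"
  assumes cont: "continuous_on UNIV f" and bound: "\<And>x. norm (f x) \<le> B" and s: "s \<longlonglongrightarrow> 0"
  shows "(\<lambda>n. heat (s n) f z) \<longlonglongrightarrow> f z"
proof -
  have [measurable]: "f \<in> borel_measurable borel" using cont by (rule borel_measurable_continuous_onI)
  have "(\<lambda>n. \<integral>t. f (z + s n *\<^sub>R t) * of_real (gauss t) \<partial>lborel) \<longlonglongrightarrow> integral\<^sup>L lborel (\<lambda>t::'a. f z * of_real (gauss t))"
  proof (rule integral_dominated_convergence[where w = "\<lambda>t::'a. B * gauss t"])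
    show "AE t in lborel. (\<lambda>n. f (z + s n *\<^sub>R t) * of_real (gauss t)) \<longlonglongrightarrow> f z * of_real (gauss t)"
    proof (intro AE_I2 tendsto_mult tendsto_const)
      fix t
      have "(\<lambda>n. z + s n *\<^sub>R t) \<longlonglongrightarrow> z + 0 *\<^sub>R t" by (intro tendsto_intros s)
      then have lim: "(\<lambda>n. z + s n *\<^sub>R t) \<longlonglongrightarrow> z" by simp
      have "isCont f z" using cont by (simp add: continuous_on_eq_continuous_at)
      then show "(\<lambda>n. f (z + s n *\<^sub>R t)) \<longlonglongrightarrow> f z" using lim by (rule isCont_tendsto_compose)
    qed
    show "AE t in lborel. norm (f (z + s n *\<^sub>R t) * of_real (gauss t)) \<le> B * gauss t" for n
      using bound by (auto simp: norm_mult gauss_pos abs_of_pos less_imp_le intro!: AE_I2 mult_right_mono)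
  qed (auto intro: gauss_integrable)
  then show ?thesis by (simp add: heat_def gauss_integral)
qed

text \<open>
  All Gaussian averages of \<open>f\<close> vanish when its Fourier transform does, and they converge to \<open>f\<close>.
\<close>

lemma fourier_uniqueness:
  fixes f :: "'a::euclidean_space \<Rightarrow> complex"
  assumes cont: "continuous_on UNIV f" and bound: "\<And>x. norm (f x) \<le> B" and f: "integrable lborel f"
    and zero: "AE \<xi> in lborel. (\<integral>x. f x * cis (- 2 * pi * (x \<bullet> \<xi>)) \<partial>lborel) = 0"
  shows "f z = 0"
proof -
  have "heat (1 / real (Suc n)) f z = 0" for n
    by (subst heat_eq_windowed_inversion[OF f, symmetric])
      (use zero in \<open>auto intro!: integral_eq_zero_AE elim!: eventually_mono\<close>)
  moreover have "(\<lambda>n. heat (1 / real (Suc n)) f z) \<longlonglongrightarrow> f z"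
    by (rule tendsto_heat[OF cont bound]) (use LIMSEQ_inverse_real_of_nat in \<open>simp add: inverse_eq_divide\<close>)
  ultimately show ?thesis by (simp add: LIMSEQ_const_iff)
qed

section \<open>Uniform decay of Gaussian averages\<close>

text \<open>
  A product weight is preferred to a power of the norm because its integrability and the behaviour
  under translations reduce to one real variable.
\<close>

definition decay :: "'a::euclidean_space \<Rightarrow> real" where
  "decay x = (\<Prod>b\<in>Basis. 1 / (1 + (x \<bullet> b)\<^sup>2))"

lemma decay_bounds: "0 < decay x" "decay x \<le> 1"
proof -
  have pos: "1 + t\<^sup>2 > (0::real)" for t using zero_le_power2[of t] by linarith
  then show "0 < decay x" unfolding decay_def by (intro prod_pos) auto
  have "1 / (1 + t\<^sup>2) \<le> (1::real)" "0 \<le> 1 / (1 + t\<^sup>2)" for t :: real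
    using pos[of t] by (simp_all add: divide_le_eq_1)
  then show "decay x \<le> 1" unfolding decay_def by (intro prod_le_1) auto
qed

lemma decay_measurable [measurable]: "decay \<in> borel_measurable borel"
  unfolding decay_def by measurable

lemma decay_integrable: "integrable lborel decay"
  unfolding decay_def
  by (intro lborel_integrable_prod)
    (use integrable_inverse_1_plus_square in \<open>simp add: set_integrable_def inverse_eq_divide\<close>)

lemma decay_integrable_affine: "c \<noteq> 0 \<Longrightarrow> integrable lborel (\<lambda>y. decay (x + c *\<^sub>R y))"
  by (intro lborel_integrable_affine decay_integrable)

text \<open>
  This is the coordinatewise Peetre inequality
  \<open>1 + z\<^sup>2 \<le> 2 (1 + t\<^sup>2) (1 + (z + s t)\<^sup>2)\<close> for \<open>|s| \<le> 1\<close>.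
\<close>

lemma decay_translate:
  assumes "\<bar>s\<bar> \<le> 1"
  shows "decay (z + s *\<^sub>R t) \<le> decay z * (\<Prod>b\<in>Basis. 2 * (1 + (t \<bullet> b)\<^sup>2))"
  unfolding decay_def prod.distrib[symmetric]
proof (intro prod_mono conjI)
  fix b :: 'a
  let ?z = "z \<bullet> b" and ?t = "t \<bullet> b"
  have pos: "1 + u\<^sup>2 > (0::real)" for u using zero_le_power2[of u] by linarith
  have "s\<^sup>2 * ?t\<^sup>2 \<le> ?t\<^sup>2"
    using assms by (simp add: abs_square_le_1 mult_left_le_one_le)
  moreover have "?z\<^sup>2 \<le> 2 * (?z + s * ?t)\<^sup>2 + 2 * (s\<^sup>2 * ?t\<^sup>2)"
    using zero_le_power2[of "?z + 2 * s * ?t"] by (simp add: power2_eq_square algebra_simps)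
  moreover have "0 \<le> ?t\<^sup>2 * (?z + s * ?t)\<^sup>2" by simp
  ultimately have "1 + ?z\<^sup>2 \<le> 2 * (1 + ?t\<^sup>2) * (1 + (?z + s * ?t)\<^sup>2)"
    using zero_le_power2[of ?t] zero_le_power2[of "?z + s * ?t"]
    by (simp only: distrib_left distrib_right mult.assoc mult_1 mult_1_right)
  then show "1 / (1 + ((z + s *\<^sub>R t) \<bullet> b)\<^sup>2) \<le> 1 / (1 + ?z\<^sup>2) * (2 * (1 + ?t\<^sup>2))"
    using pos[of ?z] pos[of "?z + s * ?t"] by (simp add: inner_add_left field_simps)
  show "0 \<le> 1 / (1 + ((z + s *\<^sub>R t) \<bullet> b)\<^sup>2)" by simp
qed

definition heat_const :: "'a::euclidean_space itself \<Rightarrow> real" where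
  "heat_const _ = integral\<^sup>L lborel (\<lambda>t::'a. (\<Prod>b\<in>Basis. 2 * (1 + (t \<bullet> b)\<^sup>2)) * gauss t)"

text \<open>
  The factor lost in translating the weight by \<open>s t\<close> is a polynomial in \<open>t\<close>, which the Gaussian
  integrates; the resulting constant does not depend on \<open>s\<close>. This supplies the dominating function
  for the limit \<open>s \<rightarrow> 0\<close>.
\<close>

lemma heat_decay:
  fixes f :: "'a::euclidean_space \<Rightarrow> complex"
  assumes [measurable]: "f \<in> borel_measurable borel" and bound: "\<And>x. norm (f x) \<le> C * decay x" and s: "\<bar>s\<bar> \<le> 1"
  shows "norm (heat s f z) \<le> C * heat_const TYPE('a) * decay z"
proof -
  let ?m = "\<lambda>t::'a. (\<Prod>b\<in>Basis. 2 * (1 + (t \<bullet> b)\<^sup>2)) * gauss t"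
  have C: "C \<ge> 0" using bound[of 0] decay_bounds[of "0::'a"] norm_ge_zero[of "f 0"]
    by (meson order_trans zero_le_mult_iff less_le_not_le)
  have "integrable lborel (\<lambda>u. 2 * (std_normal_density u * u ^ 0) + 2 * (std_normal_density u * u ^ 2))"
    by (intro Bochner_Integration.integrable_add integrable_mult_right integrable_std_normal_moment)
  then have "integrable lborel (\<lambda>u. (2 * (1 + u\<^sup>2)) * std_normal_density u)"
    by (simp add: algebra_simps)
  from lborel_integrable_prod[OF this]
  have m: "integrable lborel ?m"
    by (simp add: gauss_def prod.distrib[symmetric])
  have le: "norm (f (z + s *\<^sub>R t) * of_real (gauss t)) \<le> C * decay z * ?m t" for t
  proof -
    have "norm (f (z + s *\<^sub>R t)) \<le> C * (decay z * (\<Prod>b\<in>Basis. 2 * (1 + (t \<bullet> b)\<^sup>2)))"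
      using bound[of "z + s *\<^sub>R t"] mult_left_mono[OF decay_translate[OF s, of z t] C] by linarith
    then show ?thesis
      using gauss_pos[of t] by (simp add: norm_mult mult_right_mono mult.assoc[symmetric])
  qed
  have "norm (heat s f z) \<le> (\<integral>t. C * decay z * ?m t \<partial>lborel)"
    unfolding heat_def
  proof (rule Bochner_Integration.integral_norm_bound_integral)
    show "integrable lborel (\<lambda>t. C * decay z * ?m t)" using m by (intro integrable_mult_right)
    then show "integrable lborel (\<lambda>t. f (z + s *\<^sub>R t) * of_real (gauss t))"
      by (rule Bochner_Integration.integrable_bound) (use le in \<open>auto intro!: AE_I2 order_trans[OF le]\<close>)
  qed (rule le)
  also have "\<dots> = C * decay z * integral\<^sup>L lborel ?m" by (rule integral_mult_right_zero)
  finally show ?thesis by (simp only: heat_const_def mult_ac)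
qed

section \<open>Supports and Schwartz functions\<close>

lemma cnj_measurable [measurable]: "cnj \<in> borel_measurable borel"
  by (intro borel_measurable_continuous_onI continuous_intros)

text \<open>
  Nonempty open sets have positive measure. For continuous functions this upgrades vanishing almost
  everywhere off the support to vanishing there.
\<close>

lemma open_AE_empty:
  fixes U :: "'a::euclidean_space set"
  assumes "open U" "AE x in lborel. x \<notin> U"
  shows "U = {}"
proof (rule ccontr)
  assume "U \<noteq> {}"
  then have "\<not> negligible U" using open_not_negligible assms(1) by blast
  moreover have "U \<in> null_sets lborel"
    using assms by (subst AE_iff_null_sets) auto
  ultimately show False by (meson negligible_iff_null_sets null_sets_completionI)
qed

lemma vanishes_off_ae_supp:
  assumes cont: "continuous_on UNIV f" and x: "x \<notin> ae_supp f"
  shows "f x = 0"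
proof -
  let ?U = "- ae_supp f \<inter> {x. f x \<noteq> 0}"
  have "open {x. f x \<noteq> 0}"
    using cont by (intro open_Collect_neq) (auto intro: continuous_intros)
  then have "open ?U" by (intro open_Int open_Compl closed_ae_supp)
  moreover have "AE x in lborel. x \<notin> ?U"
    using AE_ae_supp[of f] by (auto elim!: eventually_mono)
  ultimately have "?U = {}" by (rule open_AE_empty)
  with x show ?thesis by auto
qed

lemma ae_supp_subset: "closed F \<Longrightarrow> (\<And>x. x \<notin> F \<Longrightarrow> f x = 0) \<Longrightarrow> ae_supp f \<subseteq> F"
  unfolding ae_supp_def by (intro Inter_lower) auto

lemma schwartz_continuous: "f \<in> schwartz \<Longrightarrow> continuous_on UNIV f"
  unfolding schwartz_def
  by (auto simp: continuous_on_eq_continuous_at dest!: spec[of _ "[]"] intro: differentiable_imp_continuous_within)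

lemma decay_vec: "decay x = (\<Prod>i\<in>UNIV. 1 / (1 + (x $ i)\<^sup>2))" for x :: "real^'d"
proof -
  have B: "(Basis :: (real^'d) set) = (\<lambda>i. axis i 1) ` UNIV" by (auto simp: Basis_vec_def)
  show ?thesis
    unfolding decay_def B
    by (subst prod.reindex) (auto simp: inj_on_def axis_eq_axis cart_eq_inner_axis[symmetric])
qed

text \<open>
  Expanding \<open>\<Prod>(1 + x\<^sub>i\<^sup>2)\<close> gives a sum of monomials, indexed by the sets \<open>J\<close> of coordinates from which
  the summand 1 is taken. Each monomial times \<open>f\<close> is bounded by the definition of a Schwartz function.
\<close>

lemma schwartz_decay:
  fixes f :: "real^'d \<Rightarrow> complex"
  assumes f: "f \<in> schwartz"
  obtains C where "\<And>x. norm (f x) \<le> C * decay x"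
proof -
  have "\<exists>B. \<forall>x. norm (of_real (\<Prod>i\<in>UNIV. (x $ i) ^ \<alpha> i) * f x) \<le> B" for \<alpha>
    using f by (auto simp: schwartz_def bounded_iff dest!: spec[of _ "[]"])
  then obtain B where B: "\<And>\<alpha> x. norm (of_real (\<Prod>i\<in>UNIV. (x $ i) ^ \<alpha> i) * f x) \<le> B \<alpha>" by metis
  \<comment> \<open>The exponents of the monomial for \<open>J\<close>: the factor \<open>x\<^sub>i\<^sup>2\<close> is taken for the coordinates outside \<open>J\<close>.\<close>
  define \<beta> where "\<beta> J i = (if i \<in> J then 0 else 2 :: nat)" for J :: "'d set" and i
  have "norm (f x) \<le> (\<Sum>J\<in>UNIV. B (\<beta> J)) * decay x" for x
  proof -
    have pos: "1 + t\<^sup>2 > (0::real)" for t using zero_le_power2[of t] by linarith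
    have mono: "(\<Prod>i\<in>UNIV. (x $ i) ^ \<beta> J i) = (\<Prod>i\<in>-J. (x $ i)\<^sup>2)" for J
      by (rule prod.mono_neutral_cong_right) (auto simp: \<beta>_def)
    have "(\<Prod>i\<in>UNIV. 1 + (x $ i)\<^sup>2) = (\<Sum>J\<in>UNIV. \<Prod>i\<in>UNIV. (x $ i) ^ \<beta> J i)"
      by (subst prod_add) (auto simp: mono Compl_eq_Diff_UNIV)
    then have "(\<Prod>i\<in>UNIV. 1 + (x $ i)\<^sup>2) * norm (f x) = (\<Sum>J\<in>UNIV. (\<Prod>i\<in>-J. (x $ i)\<^sup>2) * norm (f x))"
      by (simp add: sum_distrib_right mono)
    also have "\<dots> \<le> (\<Sum>J\<in>UNIV. B (\<beta> J))"
    proof (rule sum_mono)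
      fix J
      have "(\<Prod>i\<in>-J. (x $ i)\<^sup>2) * norm (f x) = norm (of_real (\<Prod>i\<in>UNIV. (x $ i) ^ \<beta> J i) * f x)"
        by (simp add: mono norm_mult abs_of_nonneg prod_nonneg del: of_real_prod)
      then show "(\<Prod>i\<in>-J. (x $ i)\<^sup>2) * norm (f x) \<le> B (\<beta> J)" using B by simp
    qed
    finally show ?thesis
      using pos by (simp add: decay_vec prod_dividef field_simps prod_pos)
  qed
  then show ?thesis by (rule that)
qed

lemma decay_constant_nonneg: "(\<And>x::'a::euclidean_space. norm (f x :: complex) \<le> C * decay x) \<Longrightarrow> C \<ge> 0"
  using decay_bounds[of "0::'a"] by (meson norm_ge_zero order_trans zero_le_mult_iff less_le_not_le)

section \<open>The \<open>\<tau>\<close>-Wigner distributions have the weak support property\<close>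

lemma fourier_cis: "fourier f \<omega> = (\<integral>x. f x * cis (- 2 * pi * (x \<bullet> \<omega>)) \<partial>lborel)"
  unfolding fourier_def by (intro Bochner_Integration.integral_cong) (auto simp: cis_conv_exp mult_ac)

lemma tau_wigner_cis:
  "tau_wigner \<tau> f (x, \<omega>) =
    (\<integral>y. f (x + \<tau> *\<^sub>R y) * cnj (f (x - (1 - \<tau>) *\<^sub>R y)) * cis (- 2 * pi * (y \<bullet> \<omega>)) \<partial>lborel)"
  unfolding tau_wigner_def
  by (auto intro!: Bochner_Integration.integral_cong simp: cis_conv_exp mult_ac inner_commute)

lemma fourier_bounded: "norm (fourier f \<omega>) \<le> (\<integral>x. norm (f x) \<partial>lborel)"
proof -
  have "norm (fourier f \<omega>) \<le> (\<integral>x. norm (f x * cis (- 2 * pi * (x \<bullet> \<omega>))) \<partial>lborel)"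
    unfolding fourier_cis by (rule integral_norm_bound)
  then show ?thesis by (simp add: norm_mult)
qed

lemma fourier_measurable:
  fixes f :: "real^'d \<Rightarrow> complex"
  assumes [measurable]: "f \<in> borel_measurable borel"
  shows "fourier f \<in> borel_measurable borel"
  unfolding fourier_cis[abs_def] by measurable

lemma heat_measurable:
  assumes [measurable]: "f \<in> borel_measurable borel"
  shows "heat s f \<in> borel_measurable borel"
  unfolding heat_def[abs_def] by measurable

text \<open>
  At least one of \<open>\<tau>\<close> and \<open>1 - \<tau>\<close> is nonzero, so one of the factors is integrable, while the other
  is at most 1.
\<close>

lemma decay_pair_integrable:
  fixes x :: "'a::euclidean_space"
  shows "integrable lborel (\<lambda>y. decay (x + \<tau> *\<^sub>R y) * decay (x - (1 - \<tau>) *\<^sub>R y))"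
proof (cases "\<tau> = 0")
  case True
  have "integrable lborel (\<lambda>y. decay (x + - 1 *\<^sub>R y))" by (rule decay_integrable_affine) simp
  then have "integrable lborel (\<lambda>y. decay x * decay (x - y))" by simp
  with True show ?thesis by simp
next
  case False
  show ?thesis
  proof (rule Bochner_Integration.integrable_bound[OF decay_integrable_affine[OF False, of x]])
    show "AE y in lborel. norm (decay (x + \<tau> *\<^sub>R y) * decay (x - (1 - \<tau>) *\<^sub>R y)) \<le> norm (decay (x + \<tau> *\<^sub>R y))"
      by (auto simp: abs_mult abs_of_pos decay_bounds less_imp_le intro!: AE_I2 mult_left_le)
  qed measurable
qed

text \<open>
  The integrand with \<open>f\<close> replaced by \<open>heat s f\<close> is, by damped Fourier inversion of both factors, a
  superposition over pairs \<open>(\<xi>, \<eta>)\<close> of waves with the frequency \<open>\<tau> \<xi> + (1 - \<tau>) \<eta>\<close>. Its coefficients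
  vanish almost everywhere unless \<open>\<xi>\<close> and \<open>\<eta>\<close> are in the support of the Fourier transform, and then
  convexity keeps the frequency at a positive distance from \<open>\<omega>\<close>. So the regularised integrals are
  zero, and they converge to the value of the distribution.
\<close>

lemma tau_wigner_vanishes_frequency:
  fixes f :: "real^'d \<Rightarrow> complex"
  assumes f: "f \<in> schwartz" and \<tau>: "\<tau> \<in> {0..1}" and \<omega>: "\<omega> \<notin> closure (convex hull (ae_supp (fourier f)))"
  shows "tau_wigner \<tau> f (x, \<omega>) = 0"
proof -
  let ?S = "ae_supp (fourier f)"
  let ?C = "closure (convex hull ?S)"
  have cont: "continuous_on UNIV f" using f by (rule schwartz_continuous)
  then have [measurable]: "f \<in> borel_measurable borel" by (rule borel_measurable_continuous_onI)
  obtain C where C: "\<And>x. norm (f x) \<le> C * decay x" using schwartz_decay[OF f] by blast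
  have C0: "C \<ge> 0" by (rule decay_constant_nonneg[OF C])
  have bound: "norm (f x) \<le> C" for x
    using C[of x] mult_left_le[of "decay x" C] decay_bounds[of x] C0 by linarith
  have f_int: "integrable lborel f"
    by (rule Bochner_Integration.integrable_bound[OF integrable_mult_right[OF decay_integrable, of C]])
      (use C in \<open>auto intro!: AE_I2 order_trans[OF C]\<close>)
  have [measurable]: "fourier f \<in> borel_measurable borel" by (rule fourier_measurable) measurable
  obtain r where r: "r > 0" "ball \<omega> r \<subseteq> - ?C"
    using \<omega> open_Compl[OF closed_closure, of "convex hull ?S"] by (metis ComplI open_contains_ball)
  \<comment> \<open>The constant in the decay of the averages \<open>heat (s n) f\<close>; it is independent of \<open>n\<close>.\<close>
  define D where "D = C * heat_const TYPE(real^'d)"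
  define s where "s n = 1 / real (Suc n)" for n
  have s: "s n > 0" "\<bar>s n\<bar> \<le> 1" for n by (auto simp: s_def)
  have s0: "s \<longlonglongrightarrow> 0" unfolding s_def using LIMSEQ_inverse_real_of_nat by (simp add: inverse_eq_divide)
  define h where "h n y = heat (s n) f (x + \<tau> *\<^sub>R y) * cnj (heat (s n) f (x - (1 - \<tau>) *\<^sub>R y))" for n y
  have h_meas: "h n \<in> borel_measurable borel" for n
  proof -
    have [measurable]: "heat (s n) f \<in> borel_measurable borel" by (rule heat_measurable) measurable
    show ?thesis unfolding h_def by measurable
  qed
  let ?w = "\<lambda>y. D * D * (decay (x + \<tau> *\<^sub>R y) * decay (x - (1 - \<tau>) *\<^sub>R y))"
  have w_int: "integrable lborel ?w" by (intro integrable_mult_right decay_pair_integrable)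
  have h_bound: "norm (h n y) \<le> ?w y" for n y
  proof -
    have H: "norm (heat (s n) f z) \<le> D * decay z" for z
      unfolding D_def by (rule heat_decay[OF _ C s(2)]) measurable
    have "norm (h n y) \<le> (D * decay (x + \<tau> *\<^sub>R y)) * (D * decay (x - (1 - \<tau>) *\<^sub>R y))"
      unfolding h_def norm_mult complex_mod_cnj
      by (intro mult_mono H) (auto intro: order_trans[OF _ H])
    then show ?thesis by (simp only: mult_ac)
  qed
  have h_int: "integrable lborel (h n)" for n
    by (rule Bochner_Integration.integrable_bound[OF w_int])
      (use h_meas in \<open>auto intro!: AE_I2 order_trans[OF h_bound]\<close>)
  have zero: "(\<integral>y. h n y * cis (- 2 * pi * (y \<bullet> \<omega>)) \<partial>lborel) = 0" for n
  proof -
    \<comment> \<open>The coefficient of the wave of frequency \<open>\<xi>\<close>, with the phase at the base point \<open>x\<close> absorbed, so that only the dependence on \<open>y\<close> remains in the waves below.\<close>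
    define k where "k \<xi> = fourier f \<xi> * of_real (window (s n) \<xi>) * cis (2 * pi * (\<xi> \<bullet> x))" for \<xi>
    let ?K = "\<lambda>z. k (fst z) * cnj (k (snd z))"
    let ?T = "\<lambda>z. \<tau> *\<^sub>R fst z + (1 - \<tau>) *\<^sub>R snd z"
    have k_int: "integrable lborel k"
    proof -
      have "integrable lborel (\<lambda>\<xi>. (\<integral>x. norm (f x) \<partial>lborel) * window (s n) (\<xi>::real^'d))"
        by (intro integrable_mult_right window_integrable s)
      then show ?thesis
      proof (rule Bochner_Integration.integrable_bound)
        show "k \<in> borel_measurable lborel" unfolding k_def by measurable
        have "norm (k \<xi>) \<le> (\<integral>x. norm (f x) \<partial>lborel) * window (s n) \<xi>" for \<xi>
          using mult_right_mono[OF fourier_bounded[of f \<xi>] less_imp_le[OF window_bounds(1)[of "s n" \<xi>]]]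
          by (simp add: k_def norm_mult window_bounds abs_of_pos)
        then show "AE \<xi> in lborel. norm (k \<xi>) \<le> norm ((\<integral>x. norm (f x) \<partial>lborel) * window (s n) \<xi>)"
          unfolding real_norm_def by (intro AE_I2 order_trans[OF _ abs_ge_self])
      qed
    qed
    have sf: "sigma_finite_measure (lborel :: (real^'d) measure)" by (rule lborel.sigma_finite_measure_axioms)
    have inv: "heat (s n) f (x + c *\<^sub>R y) = (\<integral>\<xi>. k \<xi> * cis (2 * pi * c * (y \<bullet> \<xi>)) \<partial>lborel)" for c y
    proof -
      have "cis (2 * pi * (\<xi> \<bullet> (x + c *\<^sub>R y))) = cis (2 * pi * (\<xi> \<bullet> x)) * cis (2 * pi * c * (y \<bullet> \<xi>))" for \<xi>
        by (simp add: cis_mult inner_add_right algebra_simps inner_commute)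
      then show ?thesis
        unfolding heat_eq_windowed_inversion[OF f_int s(1), symmetric] fourier_cis[symmetric] k_def
        by (simp only: mult.assoc)
    qed
    show ?thesis
    proof (rule spectral_gap_vanishing[where N = "lborel \<Otimes>\<^sub>M lborel" and k = ?K and T = ?T and r = r])
      show "sigma_finite_measure ((lborel :: (real^'d) measure) \<Otimes>\<^sub>M (lborel :: (real^'d) measure))"
        by (rule lborel_pair.sigma_finite_measure_axioms)
      have "integrable (lborel \<Otimes>\<^sub>M lborel) (\<lambda>(\<xi>, \<eta>). k \<xi> * cnj (k \<eta>))"
        by (intro integrable_tensor sf k_int integrable_cnj)
      then show "integrable (lborel \<Otimes>\<^sub>M lborel) ?K" by (simp add: case_prod_unfold)
      show "?T \<in> borel_measurable (lborel \<Otimes>\<^sub>M lborel)" by measurable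
      show "h n y = (\<integral>z. ?K z * cis (2 * pi * (y \<bullet> ?T z)) \<partial>(lborel \<Otimes>\<^sub>M lborel))" for y
      proof -
        let ?a = "\<lambda>\<xi>. k \<xi> * cis (2 * pi * \<tau> * (y \<bullet> \<xi>))" and ?b = "\<lambda>\<eta>. k \<eta> * cis (2 * pi * (\<tau> - 1) * (y \<bullet> \<eta>))"
        have x: "x - (1 - \<tau>) *\<^sub>R y = x + (\<tau> - 1) *\<^sub>R y" by (simp add: algebra_simps)
        have "h n y = integral\<^sup>L lborel ?a * (\<integral>\<eta>. cnj (?b \<eta>) \<partial>lborel)"
          unfolding h_def x inv by (simp only: Bochner_Integration.integral_cnj)
        also have "\<dots> = (\<integral>z. ?a (fst z) * cnj (?b (snd z)) \<partial>(lborel \<Otimes>\<^sub>M lborel))"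
          by (rule integral_tensor[symmetric]) (intro sf integrable_cnj integrable_mult_phase k_int, measurable)+
        also have "\<dots> = (\<integral>z. ?K z * cis (2 * pi * (y \<bullet> ?T z)) \<partial>(lborel \<Otimes>\<^sub>M lborel))"
        proof (rule arg_cong[where f = "integral\<^sup>L _"], rule ext)
          fix z
          have "cis (2 * pi * (y \<bullet> ?T z)) = cis (2 * pi * \<tau> * (y \<bullet> fst z)) * cnj (cis (2 * pi * (\<tau> - 1) * (y \<bullet> snd z)))"
            by (simp add: cis_cnj cis_mult inner_add_right algebra_simps)
          then show "?a (fst z) * cnj (?b (snd z)) = ?K z * cis (2 * pi * (y \<bullet> ?T z))"
            by simp
        qed
        finally show ?thesis .
      qed
      show "AE z in lborel \<Otimes>\<^sub>M lborel. ?K z = 0 \<or> r \<le> norm (?T z - \<omega>)"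
      proof -
        have [measurable]: "?S \<in> sets borel" by (intro borel_closed closed_ae_supp)
        let ?P = "\<lambda>z. (fst z \<in> ?S \<or> fourier f (fst z) = 0) \<and> (snd z \<in> ?S \<or> fourier f (snd z) = 0)"
        have ae: "AE \<xi> in lborel. \<xi> \<in> ?S \<or> fourier f \<xi> = 0"
          using AE_ae_supp[of "fourier f"] by (auto elim!: eventually_mono)
        have "AE z in lborel \<Otimes>\<^sub>M lborel. ?P z"
          by (rule lborel_pair.AE_pair_measure) (measurable, use ae in \<open>auto elim!: eventually_mono\<close>)
        then show ?thesis
        proof eventually_elim
          case (elim z)
          show ?case
          proof (cases "?K z = 0")
            case False
            with elim have "fst z \<in> ?S" "snd z \<in> ?S" by (auto simp: k_def)
            moreover have "?S \<subseteq> ?C" using closure_subset hull_subset by (metis order_trans)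
            moreover have "convex ?C" by (intro convex_closure convex_convex_hull)
            ultimately have "?T z \<in> ?C" using \<tau> by (intro convexD) auto
            with r(2) have "?T z \<notin> ball \<omega> r" by blast
            then show ?thesis by (simp add: dist_norm norm_minus_commute)
          qed simp
        qed
      qed
    qed (use r(1) h_int in auto)
  qed
  have lim: "(\<lambda>n. heat (s n) f z) \<longlonglongrightarrow> f z" for z by (rule tendsto_heat[OF cont bound s0])
  have "(\<lambda>n. \<integral>y. h n y * cis (- 2 * pi * (y \<bullet> \<omega>)) \<partial>lborel) \<longlonglongrightarrow> tau_wigner \<tau> f (x, \<omega>)"
    unfolding tau_wigner_cis
  proof (rule integral_dominated_convergence[where w = ?w])
    show "AE y in lborel. (\<lambda>n. h n y * cis (- 2 * pi * (y \<bullet> \<omega>)))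
        \<longlonglongrightarrow> f (x + \<tau> *\<^sub>R y) * cnj (f (x - (1 - \<tau>) *\<^sub>R y)) * cis (- 2 * pi * (y \<bullet> \<omega>))"
      unfolding h_def by (intro AE_I2 tendsto_mult tendsto_const tendsto_cnj lim)
    show "AE y in lborel. norm (h n y * cis (- 2 * pi * (y \<bullet> \<omega>))) \<le> ?w y" for n
      using h_bound by (auto simp: norm_mult)
    have [measurable]: "h n \<in> borel_measurable borel" for n by (rule h_meas)
    show "(\<lambda>y. h n y * cis (- 2 * pi * (y \<bullet> \<omega>))) \<in> borel_measurable lborel" for n by measurable
    show "(\<lambda>y. f (x + \<tau> *\<^sub>R y) * cnj (f (x - (1 - \<tau>) *\<^sub>R y)) * cis (- 2 * pi * (y \<bullet> \<omega>)))
        \<in> borel_measurable lborel" by measurable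
  qed (rule w_int)
  then show ?thesis unfolding zero by (simp add: LIMSEQ_const_iff)
qed

text \<open>
  The point \<open>x\<close> is the convex combination, with weights \<open>1 - \<tau>\<close> and \<open>\<tau>\<close>, of the two points at which
  \<open>f\<close> is evaluated; so these cannot both be in the closed convex hull of the support.
\<close>

lemma tau_wigner_vanishes_time:
  fixes f :: "real^'d \<Rightarrow> complex"
  assumes cont: "continuous_on UNIV f" and \<tau>: "\<tau> \<in> {0..1}" and x: "x \<notin> closure (convex hull (ae_supp f))"
  shows "tau_wigner \<tau> f (x, \<omega>) = 0"
proof -
  let ?C = "closure (convex hull (ae_supp f))"
  have off: "f z = 0" if "z \<notin> ?C" for z
    using vanishes_off_ae_supp[OF cont] that by (meson closure_subset hull_subset subsetD)
  have "f (x + \<tau> *\<^sub>R y) = 0 \<or> f (x - (1 - \<tau>) *\<^sub>R y) = 0" for y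
  proof (rule ccontr)
    assume "\<not> ?thesis"
    then have "x + \<tau> *\<^sub>R y \<in> ?C" "x - (1 - \<tau>) *\<^sub>R y \<in> ?C" using off by auto
    moreover have "convex ?C" by (intro convex_closure convex_convex_hull)
    ultimately have "(1 - \<tau>) *\<^sub>R (x + \<tau> *\<^sub>R y) + \<tau> *\<^sub>R (x - (1 - \<tau>) *\<^sub>R y) \<in> ?C"
      using \<tau> by (intro convexD) auto
    also have "(1 - \<tau>) *\<^sub>R (x + \<tau> *\<^sub>R y) + \<tau> *\<^sub>R (x - (1 - \<tau>) *\<^sub>R y) = x"
      by (simp add: algebra_simps)
    finally show False using x by simp
  qed
  then have "f (x + \<tau> *\<^sub>R y) * cnj (f (x - (1 - \<tau>) *\<^sub>R y)) = 0" for y by simp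
  then show ?thesis by (simp only: tau_wigner_cis) simp
qed

lemma weak_support_tau_wigner:
  assumes "\<tau> \<in> {0..1}"
  shows "weak_support (tau_wigner \<tau> :: (real^'d \<Rightarrow> complex) \<Rightarrow> _)"
  unfolding weak_support_def time_weak_support_def frequency_weak_support_def
proof (intro conjI ballI)
  fix f :: "real^'d \<Rightarrow> complex" assume f: "f \<in> schwartz"
  let ?C = "closure (convex hull (ae_supp f))" and ?D = "closure (convex hull (ae_supp (fourier f)))"
  have "ae_supp (tau_wigner \<tau> f) \<subseteq> ?C \<times> UNIV"
    using tau_wigner_vanishes_time[OF schwartz_continuous[OF f] assms]
    by (intro ae_supp_subset closed_Times) auto
  then show "fst ` ae_supp (tau_wigner \<tau> f) \<subseteq> ?C" by auto
  have "ae_supp (tau_wigner \<tau> f) \<subseteq> UNIV \<times> ?D"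
    using tau_wigner_vanishes_frequency[OF f assms]
    by (intro ae_supp_subset closed_Times) auto
  then show "snd ` ae_supp (tau_wigner \<tau> f) \<subseteq> ?D" by auto
qed

section \<open>A smooth bump on the unit ball\<close>

text \<open>
  The powers of \<open>1 / t\<close> make the family closed under differentiation up to linear combinations.
\<close>

definition flat_exp :: "nat \<Rightarrow> real \<Rightarrow> real" where
  "flat_exp k t = (if t > 0 then (1 / t) ^ k * exp (- (1 / t)) else 0)"

lemma power_div_fact_le_exp:
  fixes u :: real
  assumes "u \<ge> 0"
  shows "u ^ n / fact n \<le> exp u"
proof -
  have "(\<Sum>n\<in>{n}. inverse (fact n) *\<^sub>R u ^ n) \<le> exp u"
    unfolding exp_def using assms by (intro sum_le_suminf summable_exp_generic) auto
  then show ?thesis by (simp add: divide_inverse mult.commute)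
qed

text \<open>
  The quadratic bound makes the derivative at 0 exist and vanish. With \<open>u = 1 / t\<close> it says that
  \<open>u ^ (k + 2) \<le> fact (k + 2) * exp u\<close>, a single term of the exponential series.
\<close>

lemma flat_exp_bound: "\<bar>flat_exp k t\<bar> \<le> fact (k + 2) * t\<^sup>2"
proof (cases "t > 0")
  case True
  define u where "u = 1 / t"
  have u: "u > 0" using True by (simp add: u_def)
  have "u ^ (k + 2) / fact (k + 2) \<le> exp u" using u by (intro power_div_fact_le_exp) simp
  then have "u ^ (k + 2) * exp (- u) \<le> fact (k + 2)"
    by (simp only: exp_minus) (simp add: divide_simps mult.commute del: fact_Suc power_Suc add_2_eq_Suc')
  then have "u\<^sup>2 * (u ^ k * exp (- u)) \<le> fact (k + 2)"
    by (simp only: power_add mult_ac)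
  then have "t\<^sup>2 * (u\<^sup>2 * (u ^ k * exp (- u))) \<le> t\<^sup>2 * fact (k + 2)"
    by (rule mult_left_mono) simp
  moreover have "t\<^sup>2 * (u\<^sup>2 * E) = E" for E
    using True by (simp add: u_def power_divide)
  ultimately have "u ^ k * exp (- u) \<le> fact (k + 2) * t\<^sup>2"
    by (simp only: mult.commute)
  then show ?thesis using True u by (simp add: flat_exp_def u_def[symmetric])
qed (simp add: flat_exp_def)

lemma flat_exp_deriv: "(flat_exp k has_real_derivative flat_exp (k + 2) t - real k * flat_exp (k + 1) t) (at t)"
proof -
  consider "t > 0" | "t < 0" | "t = 0" by linarith
  then show ?thesis
  proof cases
    case 1
    define v where "v = 1 / t"
    have v: "((\<lambda>t. 1 / t) has_real_derivative - (v\<^sup>2)) (at t)"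
      using 1 by (auto intro!: derivative_eq_intros simp: v_def power2_eq_square)
    have "((\<lambda>t. (1 / t) ^ k * exp (- (1 / t))) has_real_derivative
        real k * (- (v\<^sup>2) * v ^ (k - Suc 0)) * exp (- v) + exp (- v) * - (- (v\<^sup>2)) * v ^ k) (at t)"
      using DERIV_mult[OF DERIV_power[OF v, of k] DERIV_fun_exp[OF DERIV_minus[OF v]]]
      unfolding v_def[symmetric] by simp
    moreover have "real k * (- (v\<^sup>2) * v ^ (k - Suc 0)) * exp (- v) + exp (- v) * - (- (v\<^sup>2)) * v ^ k
        = v ^ (k + 2) * exp (- v) - real k * (v ^ (k + 1) * exp (- v))"
      by (cases k) (simp_all add: power2_eq_square)
    ultimately have "((\<lambda>t. (1 / t) ^ k * exp (- (1 / t))) has_real_derivative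
        flat_exp (k + 2) t - real k * flat_exp (k + 1) t) (at t)"
      using 1 by (simp only: flat_exp_def if_True v_def)
    then show ?thesis
      by (rule has_field_derivative_transform_within_open[of _ _ _ "{0<..}"]) (use 1 in \<open>auto simp: flat_exp_def\<close>)
  next
    case 2
    have "((\<lambda>t. 0) has_real_derivative 0) (at t)" by simp
    then have "(flat_exp k has_real_derivative 0) (at t)"
      by (rule has_field_derivative_transform_within_open[of _ _ _ "{..<0}"]) (use 2 in \<open>auto simp: flat_exp_def\<close>)
    with 2 show ?thesis by (simp add: flat_exp_def)
  next
    case 3
    have "(\<lambda>h. (flat_exp k (0 + h) - flat_exp k 0) / h) \<midarrow>0\<rightarrow> 0"
    proof (rule Lim_null_comparison)
      show "\<forall>\<^sub>F h in at 0. norm ((flat_exp k (0 + h) - flat_exp k 0) / h) \<le> fact (k + 2) * \<bar>h\<bar>"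
      proof (intro always_eventually allI)
        fix h :: real
        show "norm ((flat_exp k (0 + h) - flat_exp k 0) / h) \<le> fact (k + 2) * \<bar>h\<bar>"
          using flat_exp_bound[of k h] by (cases "h = 0") (simp_all add: flat_exp_def[of k 0] divide_le_eq power2_eq_square mult.assoc)
      qed
      show "((\<lambda>h::real. fact (k + 2) * \<bar>h\<bar>) \<longlongrightarrow> 0) (at 0)"
        by (intro tendsto_mult_right_zero tendsto_rabs_zero tendsto_ident_at)
    qed
    with 3 show ?thesis by (simp add: DERIV_def flat_exp_def)
  qed
qed

text \<open>
  An algebra of functions that contains the bump and is closed under partial derivatives. Membership
  thus yields differentiability of all iterated partial derivatives without describing them.
\<close>

inductive_set bump_algebra :: "(real^'d \<Rightarrow> complex) set" where
  const: "(\<lambda>_. c) \<in> bump_algebra"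
| coord: "(\<lambda>x. of_real (x $ i)) \<in> bump_algebra"
| flat: "(\<lambda>x. of_real (flat_exp k (1 - x \<bullet> x))) \<in> bump_algebra"
| add: "G \<in> bump_algebra \<Longrightarrow> H \<in> bump_algebra \<Longrightarrow> (\<lambda>x. G x + H x) \<in> bump_algebra"
| mult: "G \<in> bump_algebra \<Longrightarrow> H \<in> bump_algebra \<Longrightarrow> (\<lambda>x. G x * H x) \<in> bump_algebra"

lemma partial_deriv_eq: "(G has_derivative D) (at x) \<Longrightarrow> partial_deriv j G x = D (axis j 1)"
  by (simp add: partial_deriv_def frechet_derivative_at[symmetric])

lemma differentiable_has_derivative:
  "G differentiable (at x) \<Longrightarrow> (G has_derivative frechet_derivative G (at x)) (at x)"
  by (simp add: frechet_derivative_works)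

lemma bump_algebra_deriv:
  fixes G :: "real^'d \<Rightarrow> complex"
  assumes "G \<in> bump_algebra"
  shows "(\<forall>x. G differentiable (at x)) \<and> (\<forall>j. partial_deriv j G \<in> bump_algebra)"
  using assms
proof induction
  case (const c)
  have "partial_deriv j (\<lambda>_. c) = (\<lambda>_::real^'d. 0)" for j
    by (rule ext, subst partial_deriv_eq[of _ "\<lambda>_. 0"]) auto
  then show ?case by (auto intro: bump_algebra.const)
next
  case (coord i)
  have D: "((\<lambda>x::real^'d. complex_of_real (x $ i)) has_derivative (\<lambda>h. of_real (h $ i))) (at x)" for x
    by (intro bounded_linear_imp_has_derivative
        bounded_linear_compose[OF bounded_linear_of_real bounded_linear_vec_nth])
  have "partial_deriv j (\<lambda>x::real^'d. complex_of_real (x $ i)) = (\<lambda>_. of_real (axis j 1 $ i))" for j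
    by (rule ext) (rule partial_deriv_eq[OF D])
  then show ?case using D by (auto intro: bump_algebra.const differentiableI)
next
  case (flat k)
  let ?q = "\<lambda>x::real^'d. 1 - x \<bullet> x"
  let ?D = "\<lambda>x. flat_exp (k + 2) (?q x) - real k * flat_exp (k + 1) (?q x)"
  have D: "((\<lambda>x. complex_of_real (flat_exp k (?q x))) has_derivative
      (\<lambda>h. of_real (?D x * (- 2 * (x \<bullet> h))))) (at x)" for x
  proof -
    have "(?q has_derivative (\<lambda>h. - 2 * (x \<bullet> h))) (at x)"
      by (auto intro!: derivative_eq_intros simp: inner_commute)
    moreover have "(flat_exp k has_derivative (\<lambda>u. ?D x * u)) (at (?q x))"
      using flat_exp_deriv[of k "?q x"] by (simp add: has_field_derivative_def)
    ultimately have "((\<lambda>x. flat_exp k (?q x)) has_derivative (\<lambda>h. ?D x * (- 2 * (x \<bullet> h)))) (at x)"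
      by (rule has_derivative_compose)
    then show ?thesis by (rule has_derivative_of_real)
  qed
  let ?P = "\<lambda>j x. (of_real (flat_exp (k + 2) (?q x)) + (- of_real (real k)) * of_real (flat_exp (k + 1) (?q x))) * ((- 2) * of_real (x $ j))"
  have "?P j \<in> bump_algebra" for j by (intro bump_algebra.intros)
  moreover have "partial_deriv j (\<lambda>x. complex_of_real (flat_exp k (?q x))) = ?P j" for j
    by (rule ext) (simp add: partial_deriv_eq[OF D] inner_axis)
  moreover have "(\<lambda>x. complex_of_real (flat_exp k (?q x))) differentiable (at x)" for x
    using D by (rule differentiableI)
  ultimately show ?case by simp
next
  case (add G H)
  then have D: "((\<lambda>x. G x + H x) has_derivative
      (\<lambda>h. frechet_derivative G (at x) h + frechet_derivative H (at x) h)) (at x)" for x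
    by (intro has_derivative_add differentiable_has_derivative) auto
  have "partial_deriv j (\<lambda>x. G x + H x) = (\<lambda>x. partial_deriv j G x + partial_deriv j H x)" for j
    by (rule ext) (simp add: partial_deriv_eq[OF D] partial_deriv_def)
  with add D show ?case by (auto intro: bump_algebra.add differentiableI)
next
  case (mult G H)
  then have D: "((\<lambda>x. G x * H x) has_derivative
      (\<lambda>h. G x * frechet_derivative H (at x) h + frechet_derivative G (at x) h * H x)) (at x)" for x
    by (intro has_derivative_mult differentiable_has_derivative) auto
  have "partial_deriv j (\<lambda>x. G x * H x) = (\<lambda>x. G x * partial_deriv j H x + partial_deriv j G x * H x)" for j
    by (rule ext) (simp add: partial_deriv_eq[OF D] partial_deriv_def)
  with mult D show ?case by (auto intro!: bump_algebra.add bump_algebra.mult intro: differentiableI)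
qed

lemma partial_deriv_vanishes:
  assumes "open U" "\<And>x. x \<in> U \<Longrightarrow> G x = 0" "x \<in> U"
  shows "partial_deriv j G x = 0"
proof -
  have "((\<lambda>_. 0) has_derivative (\<lambda>_. 0)) (at x)" by simp
  then have "(G has_derivative (\<lambda>_. 0)) (at x)"
    by (rule has_derivative_transform_within_open[OF _ assms(1,3)]) (simp add: assms(2))
  then show ?thesis by (simp add: partial_deriv_eq)
qed

definition bump :: "real^'d \<Rightarrow> complex" where
  "bump x = of_real (flat_exp 0 (1 - x \<bullet> x))"

lemma bump_zero_iff: "bump x = 0 \<longleftrightarrow> 1 \<le> norm x"
proof -
  have "0 < 1 - x \<bullet> x \<longleftrightarrow> norm x < 1"
    by (simp add: power2_norm_eq_inner[symmetric] abs_square_less_1)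
  then show ?thesis by (simp add: bump_def flat_exp_def linorder_not_less)
qed

text \<open>
  Every iterated partial derivative stays in the algebra and stays zero off the closed unit ball, so
  its product with a monomial is continuous with compact support, and therefore bounded.
\<close>

lemma bump_schwartz: "(bump :: real^'d \<Rightarrow> complex) \<in> schwartz"
proof -
  have main: "fold partial_deriv js G \<in> bump_algebra \<and> (\<forall>x\<in>- cball 0 1. fold partial_deriv js G x = 0)"
    if "G \<in> bump_algebra" "\<forall>x\<in>- cball 0 1. G x = 0" for G :: "real^'d \<Rightarrow> complex" and js
    using that
  proof (induction js arbitrary: G)
    case (Cons j js)
    have "partial_deriv j G \<in> bump_algebra" using bump_algebra_deriv Cons.prems by blast
    moreover have "\<forall>x\<in>- cball 0 1. partial_deriv j G x = 0"
      using partial_deriv_vanishes[of "- cball 0 1" G] Cons.prems(2) by (auto simp: open_Compl)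
    ultimately show ?case using Cons.IH by simp
  qed simp
  show ?thesis
    unfolding schwartz_def
  proof (intro CollectI allI conjI)
    fix js :: "'d list"
    let ?G = "fold partial_deriv js (bump :: real^'d \<Rightarrow> complex)"
    have "bump \<in> bump_algebra" unfolding bump_def[abs_def] by (rule bump_algebra.flat)
    moreover have "\<forall>x\<in>- cball 0 1. (bump :: real^'d \<Rightarrow> complex) x = 0" by (simp add: bump_zero_iff)
    ultimately have G: "?G \<in> bump_algebra" "\<forall>x\<in>- cball 0 1. ?G x = 0" using main by auto
    have diff: "?G differentiable (at x)" for x using bump_algebra_deriv[OF G(1)] by blast
    show "?G differentiable (at x)" for x by (rule diff)
    fix \<alpha> :: "'d \<Rightarrow> nat"
    let ?H = "\<lambda>x. of_real (\<Prod>i\<in>UNIV. (x $ i) ^ \<alpha> i) * ?G x"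
    have "continuous_on (cball 0 1) ?G"
      using diff by (auto intro!: continuous_at_imp_continuous_on differentiable_imp_continuous_within)
    then have "continuous_on (cball 0 1) ?H" by (intro continuous_intros)
    then have "bounded (?H ` cball 0 1)" by (intro compact_imp_bounded compact_continuous_image) auto
    then have "bounded (insert 0 (?H ` cball 0 1))" by simp
    then show "bounded (range ?H)"
      by (rule bounded_subset) (use G(2) in auto)
  qed
qed

section \<open>The time property forces a scalar matrix\<close>

lemma cohen_matrix_blocks:
  "block11 (cohen_matrix M) = mat 1" "block12 (cohen_matrix M) = M + (1/2) *\<^sub>R mat 1"
  "block21 (cohen_matrix M) = mat 1" "block22 (cohen_matrix M) = M - (1/2) *\<^sub>R mat 1"
  by (simp_all add: vec_eq_iff cohen_matrix_def block_matrix_def block11_def block12_def block21_def block22_def)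

lemma matrix_wigner_cohen:
  fixes M :: "real^'d^'d"
  defines "P \<equiv> M + (1/2) *\<^sub>R mat 1"
  shows "matrix_wigner (cohen_matrix M) f (x, \<omega>) =
    (\<integral>y. f (x + P *v y) * cnj (f (x + P *v y - y)) * cis (- 2 * pi * (y \<bullet> \<omega>)) \<partial>lborel)"
proof -
  have "(M - (1/2) *\<^sub>R mat 1) *v y = P *v y - y" for y
  proof -
    have "M - (1/2) *\<^sub>R mat 1 = P - mat 1"
      by (simp add: P_def vec_eq_iff mat_def)
    then show ?thesis by (simp add: matrix_vector_mult_diff_rdistrib)
  qed
  then show ?thesis
    by (auto intro!: Bochner_Integration.integral_cong
        simp: matrix_wigner_def cohen_matrix_blocks P_def[symmetric] cis_conv_exp inner_commute mult_ac add_diff_eq)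
qed

lemma matrix_wigner_scalar:
  fixes f :: "real^'d \<Rightarrow> complex"
  shows "matrix_wigner (cohen_matrix ((\<tau> - 1/2) *\<^sub>R mat 1)) f = tau_wigner \<tau> f"
proof (rule ext, clarify)
  fix x \<omega> :: "real^'d"
  have P: "(\<tau> - 1/2) *\<^sub>R mat 1 + (1/2) *\<^sub>R mat 1 = (\<tau> *\<^sub>R mat 1 :: real^'d^'d)"
    by (simp add: scaleR_left_distrib[symmetric])
  have v: "(\<tau> *\<^sub>R mat 1) *v y = \<tau> *\<^sub>R y" for y :: "real^'d"
    by (simp add: scaleR_matrix_vector_assoc[symmetric])
  show "matrix_wigner (cohen_matrix ((\<tau> - 1/2) *\<^sub>R mat 1)) f (x, \<omega>) = tau_wigner \<tau> f (x, \<omega>)"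
    unfolding matrix_wigner_cohen tau_wigner_cis P v by (simp add: algebra_simps)
qed

lemma bump_continuous: "continuous_on S bump"
  using schwartz_continuous[OF bump_schwartz] continuous_on_subset by blast

lemma bump_le_1: "norm (bump x) \<le> 1"
  by (simp add: bump_def flat_exp_def)

lemma ae_supp_bump: "closure (convex hull (ae_supp (bump :: real^'d \<Rightarrow> complex))) \<subseteq> cball 0 1"
proof -
  have "ae_supp (bump :: real^'d \<Rightarrow> complex) \<subseteq> cball 0 1"
    by (rule ae_supp_subset) (auto simp: bump_zero_iff)
  then show ?thesis by (intro closure_minimal hull_minimal) auto
qed

text \<open>
  Suppose that the point \<open>x = a - P (a - b)\<close> lies outside the closed ball. The points \<open>x\<close> off the
  ball at which the integrand does not vanish for \<open>y = a - b\<close> form an open set \<open>U\<close>. By the support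
  property and Fubini, for almost every \<open>x\<close> in \<open>U\<close> the Fourier transform of the integrand is zero
  almost everywhere, so the integrand is zero: a contradiction unless \<open>U\<close> is null, hence empty.
\<close>

lemma time_support_ball:
  fixes M :: "real^'d^'d"
  defines "P \<equiv> M + (1/2) *\<^sub>R mat 1"
  assumes time: "time_weak_support (matrix_wigner (cohen_matrix M))"
    and a: "a \<in> ball 0 1" and b: "b \<in> ball 0 1"
  shows "norm (a - P *v (a - b)) \<le> 1"
proof (rule ccontr)
  assume out: "\<not> ?thesis"
  let ?Q = "matrix_wigner (cohen_matrix M) (bump :: real^'d \<Rightarrow> complex)"
  define y where "y = a - b"
  define h where "h x y = bump (x + P *v y) * cnj (bump (x + P *v y - y))" for x y
  define U where "U = - cball 0 1 \<inter> {x. h x y \<noteq> 0}"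
  have "a - P *v y \<in> U"
    using out a b by (auto simp: U_def h_def y_def bump_zero_iff)
  moreover have "U = {}"
  proof (rule open_AE_empty)
    have "open {x. h x y \<noteq> 0}"
      unfolding h_def by (intro open_Collect_neq continuous_intros continuous_on_compose2[OF bump_continuous[of UNIV]]) auto
    then show "open U" unfolding U_def by (intro open_Int open_Compl closed_cball)
    have "AE z in lborel. fst z \<notin> cball 0 1 \<longrightarrow> ?Q z = 0"
      using AE_ae_supp[of ?Q]
    proof eventually_elim
      case (elim z)
      have "fst ` ae_supp ?Q \<subseteq> cball 0 1"
        using time bump_schwartz ae_supp_bump unfolding time_weak_support_def by blast
      with elim show ?case by blast
    qed
    then have "AE z in lborel \<Otimes>\<^sub>M lborel. fst z \<notin> cball 0 1 \<longrightarrow> ?Q z = 0"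
      by (simp only: lborel_prod)
    then have "AE x in lborel. AE \<omega> in lborel. fst (x, \<omega>) \<notin> cball 0 1 \<longrightarrow> ?Q (x, \<omega>) = 0"
      by (rule lborel_pair.AE_pair)
    then show "AE x in lborel. x \<notin> U"
    proof eventually_elim
      case (elim x)
      show ?case
      proof
        assume x: "x \<in> U"
        have cont: "continuous_on S (h x)" for S
          unfolding h_def by (intro continuous_intros continuous_on_compose2[OF bump_continuous[of UNIV]] matrix_vector_mult_linear_continuous_on) auto
        have bound: "norm (h x y) \<le> 1" for y
          unfolding h_def norm_mult complex_mod_cnj by (intro mult_le_one bump_le_1) auto
        \<comment> \<open>The two points of evaluation differ by \<open>y\<close>, so they are both in the unit ball only if \<open>|y| < 2\<close>.\<close>
        have supp: "h x y = indicator (cball 0 2) y *\<^sub>R h x y" for y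
        proof (cases "h x y = 0")
          case False
          then have "norm (x + P *v y) < 1" "norm (x + P *v y - y) < 1"
            by (auto simp: h_def bump_zero_iff)
          then have "norm ((x + P *v y) - (x + P *v y - y)) < 2"
            using norm_triangle_ineq4[of "x + P *v y" "x + P *v y - y"] by linarith
          then show ?thesis by simp
        qed simp
        have "integrable lborel (\<lambda>y. indicator (cball 0 2) y *\<^sub>R h x y)"
          by (rule borel_integrable_compact[OF compact_cball cont])
        then have int: "integrable lborel (h x)" using supp by simp
        have "AE \<omega> in lborel. (\<integral>y. h x y * cis (- 2 * pi * (y \<bullet> \<omega>)) \<partial>lborel) = 0"
          using elim
        proof eventually_elim
          case (elim \<omega>)
          then show ?case using x unfolding U_def matrix_wigner_cohen P_def[symmetric] h_def by auto
        qed
        then have "h x y = 0" by (rule fourier_uniqueness[OF cont bound int])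
        with x show False by (simp add: U_def)
      qed
    qed
  qed
  ultimately show False by blast
qed

text \<open>
  Let \<open>p = P\<^sup>T u\<close> and \<open>q = u - p\<close>. As \<open>u \<bullet> (a - P (a - b)) = q \<bullet> a + p \<bullet> b\<close>, choosing \<open>a\<close> and \<open>b\<close>
  in the directions of \<open>q\<close> and \<open>p\<close>, with lengths tending to 1, gives \<open>|q| + |p| \<le> |u| = |p + q|\<close>.
  Equality in the triangle inequality makes \<open>p\<close> and \<open>q\<close> nonnegative multiples of a common vector.
\<close>

lemma transpose_eigenvector:
  fixes P :: "real^'d^'d"
  assumes ball: "\<And>a b. a \<in> ball 0 1 \<Longrightarrow> b \<in> ball 0 1 \<Longrightarrow> norm (a - P *v (a - b)) \<le> 1"
  shows "\<exists>c\<in>{0..1}. transpose P *v u = c *\<^sub>R u"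
proof (cases "u = 0")
  case False
  define p where "p = transpose P *v u"
  define q where "q = u - p"
  have self: "z \<bullet> sgn z = norm z" for z :: "real^'d"
    by (cases "z = 0") (simp_all add: sgn_div_norm power2_norm_eq_inner[symmetric] power2_eq_square)
  have "norm p + norm q \<le> norm u"
  proof (rule field_le_mult_one_interval)
    fix r :: real assume r: "0 < r" "r < 1"
    let ?a = "r *\<^sub>R sgn q" and ?b = "r *\<^sub>R sgn p"
    have ab: "?a \<in> ball 0 1" "?b \<in> ball 0 1" using r by (auto simp: norm_sgn)
    have dot: "u \<bullet> (P *v z) = p \<bullet> z" for z
      by (simp add: p_def dot_lmul_matrix[symmetric] vector_transpose_matrix inner_commute)
    have "r * (norm p + norm q) = u \<bullet> (?a - P *v (?a - ?b))"
    proof -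
      have "u \<bullet> (?a - P *v (?a - ?b)) = q \<bullet> ?a + p \<bullet> ?b"
        by (simp add: inner_diff_right dot q_def inner_diff_left algebra_simps)
      then show ?thesis by (simp add: self algebra_simps)
    qed
    also have "\<dots> \<le> norm u * norm (?a - P *v (?a - ?b))" by (rule norm_cauchy_schwarz)
    also have "\<dots> \<le> norm u" using ball[OF ab] by (intro mult_left_le) auto
    finally show "r * (norm p + norm q) \<le> norm u" .
  qed
  moreover have u: "u = p + q" by (simp add: q_def)
  ultimately have eq: "norm (p + q) = norm p + norm q"
    by (intro antisym norm_triangle_ineq) simp
  then have "norm p *\<^sub>R q = norm q *\<^sub>R p" by (rule norm_triangle_eq[THEN iffD1])
  then have "norm u *\<^sub>R p = norm p *\<^sub>R u"
    unfolding u eq by (simp add: scaleR_left_distrib scaleR_right_distrib)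
  then have "p = (norm p / norm u) *\<^sub>R u"
    using False by (metis (no_types, lifting) divide_inverse_commute norm_eq_zero scaleR_one scaleR_scaleR left_inverse)
  moreover have "norm p / norm u \<in> {0..1}"
  proof -
    have "norm p \<le> norm u" using eq unfolding u[symmetric] by simp
    then show ?thesis using False by (simp add: divide_le_eq_1)
  qed
  ultimately show ?thesis unfolding p_def by blast
qed (auto intro: bexI[of _ 0])

text \<open>
  The basis vectors make the matrix diagonal, and the vectors \<open>e\<^sub>i + e\<^sub>j\<close> identify its diagonal entries.
\<close>

lemma scalar_matrix_if_all_eigenvectors:
  fixes A :: "real^'d^'d"
  assumes eig: "\<And>u. \<exists>c\<in>S. A *v u = c *\<^sub>R u"
  shows "\<exists>c\<in>S. A = c *\<^sub>R mat 1"
proof -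
  obtain l where l: "\<And>u. l u \<in> S" "\<And>u. A *v u = l u *\<^sub>R u" using eig by metis
  let ?e = "\<lambda>i::'d. axis i (1::real)"
  have entry: "A $ j $ i = l (?e i) * ?e i $ j" for i j
    using arg_cong[OF l(2)[of "?e i"], of "\<lambda>v. v $ j"]
    by (simp add: matrix_vector_mul_component inner_axis)
  have same: "l (?e i) = l (?e j)" for i j
  proof (cases "i = j")
    case False
    have c: "A $ k $ i + A $ k $ j = l (?e i + ?e j) * (?e i $ k + ?e j $ k)" for k
      using arg_cong[OF l(2)[of "?e i + ?e j"], of "\<lambda>v. v $ k"]
      by (simp add: matrix_vector_mul_component inner_axis inner_add_right)
    from c[of i] c[of j] False show ?thesis by (simp add: entry axis_def)
  qed simp
  obtain i0 :: 'd where True by simp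
  have "A = l (?e i0) *\<^sub>R mat 1"
    using same by (simp add: vec_eq_iff entry mat_def axis_def)
  then show ?thesis using l(1) by blast
qed

lemma scalar_if_time_weak_support:
  fixes M :: "real^'d^'d"
  assumes "time_weak_support (matrix_wigner (cohen_matrix M))"
  shows "\<exists>\<tau>\<in>{0..1}. M = (\<tau> - 1/2) *\<^sub>R mat 1"
proof -
  let ?P = "M + (1/2) *\<^sub>R mat 1"
  have "\<exists>\<tau>\<in>{0..1}. transpose ?P = \<tau> *\<^sub>R mat 1"
    by (intro scalar_matrix_if_all_eigenvectors transpose_eigenvector time_support_ball assms)
  then obtain \<tau> where \<tau>: "\<tau> \<in> {0..1}" "transpose ?P = \<tau> *\<^sub>R mat 1" by blast
  have "?P = transpose (\<tau> *\<^sub>R mat 1)" by (metis \<tau>(2) transpose_transpose)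
  then have "?P = \<tau> *\<^sub>R mat 1" by (simp add: transpose_scalar transpose_mat)
  then have "M = (\<tau> - 1/2) *\<^sub>R mat 1" by (simp add: scaleR_left_diff_distrib eq_diff_eq)
  with \<tau>(1) show ?thesis by blast
qed

theorem theorem4p7:
  fixes M :: "real^'d^'d"
  shows "(weak_support (matrix_wigner (cohen_matrix M)) \<longleftrightarrow>
            (\<exists>\<tau>\<in>{0..1}. \<forall>f\<in>schwartz. matrix_wigner (cohen_matrix M) f = tau_wigner \<tau> f))
       \<and> (weak_support (matrix_wigner (cohen_matrix M)) \<longleftrightarrow>
            (\<exists>\<tau>\<in>{0..1}. M = (\<tau> - 1/2) *\<^sub>R mat 1))"
proof -
  let ?Q = "matrix_wigner (cohen_matrix M)"
  have weak: "\<exists>\<tau>\<in>{0..1}. M = (\<tau> - 1/2) *\<^sub>R mat 1" if "weak_support ?Q"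
    using that by (intro scalar_if_time_weak_support) (simp add: weak_support_def)
  have scalar: "\<exists>\<tau>\<in>{0..1}. \<forall>f\<in>schwartz. ?Q f = tau_wigner \<tau> f"
    if "\<exists>\<tau>\<in>{0..1}. M = (\<tau> - 1/2) *\<^sub>R mat 1"
    using that matrix_wigner_scalar by blast
  have wigner: "weak_support ?Q" if ex: "\<exists>\<tau>\<in>{0..1}. \<forall>f\<in>schwartz. ?Q f = tau_wigner \<tau> f"
  proof -
    obtain \<tau> where \<tau>: "\<tau> \<in> {0..1}" "\<forall>f\<in>schwartz. ?Q f = tau_wigner \<tau> f" using ex by blast
    show ?thesis
      using weak_support_tau_wigner[OF \<tau>(1), where 'd = 'd] \<tau>(2)
      by (simp add: weak_support_def time_weak_support_def frequency_weak_support_def)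
  qed
  from weak scalar wigner show ?thesis by blast
qed

end
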